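(* Let $(\mathcal O,\mathcal C,\mathbf 2_{\mathcal C},\iota)$ be an SFC-category. Then the assignments $C\mapsto \mathsf{pt}_{\mathcal C}(C)$ and $X\mapsto \Omega_{\mathcal C}X$ are the object parts of functors $\mathsf{pt}_{\mathcal C}:\mathcal C\to \mathbf{Top}_{\mathcal C}^{\mathrm{op}}$ and $\Omega_{\mathcal C}:\mathbf{Top}_{\mathcal C}^{\mathrm{op}}\to\mathcal C$ (acting on morphisms as described in the context), and there is an adjunction $\mathsf{pt}_{\mathcal C}\dashv\Omega_{\mathcal C}$, with units $\eta^{\mathcal C}$ and $\sigma^{\mathcal C}$ as described in the context. This dual adjunction is represented by the pair $(\mathbf 2_{\mathcal C},\mathbb S)$ and is natural.
   Context: $\mathbf{Frm}$ is the category of frames and frame homomorphisms, $\mathbf 2=\{0<1\}$, $\mathbf{Top}$ is the category of topological spaces, $\mathbb S$ is the Sierpinski space ($\{0,1\}$ with opens $\emptyset,\{1\},\{0,1\}$). $|\cdot|$ denotes underlying sets and functions; $|\mathbf 2|=|\mathbb S|$. $\mathbf{Top}(X,\mathbb S)$ is identified with the frame $\Omega(X)$ of opens of $X$. Lifts. Let $U:\mathcal A\to\mathcal B$ be a faithful functor. A morphism $f:U(A)\to U(A')$ lifts if $f=U(p)$ for a (necessarily unique) $p:A\to A'$, called the lift of $f$. A cartesian lift (w.r.t. $U$) of a family $\{f_i:X\to U(C)\mid i\in I\}$ is a pair $(\overline X,\theta)$ with $\overline X\in\mathcal A$ and $\theta:U(\overline X)\to X$ an isomorphism, such that for every $D\in\mathcal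 A$ a morphism $h:U(D)\to U(\overline X)$ lifts to a morphism $D\to\overline X$ if and only if every $f_i\theta h$ lifts to a morphism $D\to C$. A family $\{p_i:D\to C\}$ in $\mathcal A$ is cartesian if $(D,\mathrm{id}_{U(D)})$ is a cartesian lift of $\{U(p_i)\}$. A PFC-category is a quadruple $(\mathcal O,\mathcal C,\mathbf 2_{\mathcal C},\iota)$ with $\mathcal O:\mathcal C\to\mathbf{Frm}$ a faithful functor, $\mathbf 2_{\mathcal C}\in\mathcal C$, and $\iota:\mathcal O(\mathbf 2_{\mathcal C})\to\mathbf 2$ an isomorphism of frames. $\mathbf{Top}_{\mathcal C}$ is the full subcategory of $\mathbf{Top}$ of those spaces $X$ for which the family $\{|\iota^{-1}|\circ\chi_x:\mathbf{Top}(X,\mathbb S)\to|\mathcal O(\mathbf 2_{\mathcal C})|\mid x\in X\}$, where $\chi_x(g)=g(x)$, has a cartesian lift $(\Omega_{\mathcal C}X,\theta_X)$ with respect to $|\mathcal O(-)|:\mathcal C\to\mathbf{Set}$; a choice of such lift is fixed, and $\overline{\chi_x}:\Omega_{\mathcal C}X\to\mathbf 2_{\mathcal C}$ is the lift of $|\iota^{-1}|\circ\chi_x\circ\theta_X$. For $C\in\mathcal C$, $\mathsf{pt}_{\mathcal C}(C)$ is the set $\mathcal C(C,\mathbf 2_{\mathcal C})$ with opens the sets $\{f\mid \iota(\mathcal Of(a))=1\}$, $a\in\mathcal O(C)$. The PFC-category is an SFC-category (spatializable) if $\mathbb S\in\mathbf{Top}_{\mathcal C}$ and $\mathsf{pt}_{\mathcal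 C}(C)\in\mathbf{Top}_{\mathcal C}$ for all $C\in\mathcal C$. On morphisms: $\mathsf{pt}_{\mathcal C}$ sends $f:C\to D$ to precomposition with $f$; $\Omega_{\mathcal C}$ sends a continuous $f:X\to Y$ to the lift of $\theta_X^{-1}\circ(-\circ f)\circ\theta_Y$. Units: $\sigma^{\mathcal C}_X:X\to\mathsf{pt}_{\mathcal C}\Omega_{\mathcal C}X$, $x\mapsto\overline{\chi_x}$ (a map in $\mathbf{Top}_{\mathcal C}$), and $\eta^{\mathcal C}_C:C\to\Omega_{\mathcal C}\mathsf{pt}_{\mathcal C}C$ is the lift of the function $|\mathcal O(C)|\to|\mathcal O\Omega_{\mathcal C}\mathsf{pt}_{\mathcal C}C|$ which, followed by $\theta_{\mathsf{pt}_{\mathcal C}C}$, is $a\mapsto(f\mapsto\iota(\mathcal Of(a)))$. Carrier functors are $|\mathcal O(-)|:\mathcal C\to\mathbf{Set}$ and the underlying-set functor on $\mathbf{Top}_{\mathcal C}$. The dual adjunction is represented by $(\mathbf 2_{\mathcal C},\mathbb S)$ if there are natural isomorphisms $\phi:|\mathsf{pt}_{\mathcal C}(-)|\cong\mathcal C(-,\mathbf 2_{\mathcal C})$ and $\gamma:|\mathcal O\Omega_{\mathcal C}(-)|\cong\mathbf{Top}_{\mathcal C}(-,\mathbb S)$ (here $\phi=\mathrm{id}$, $\gamma=\theta$). It is natural if, with respect to the carrier functors, the families $\{\gamma_{\mathsf{pt}_{\mathcal C}C}(|\mathcal O\eta^{\mathcal C}_C|(c)):\mathsf{pt}_{\mathcal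 C}C\to\mathbb S\mid c\in|\mathcal O(C)|\}$ and $\{\phi_{\Omega_{\mathcal C}X}(|\sigma^{\mathcal C}_X|(x)):\Omega_{\mathcal C}X\to\mathbf 2_{\mathcal C}\mid x\in|X|\}$ are cartesian for all $C\in\mathcal C$, $X\in\mathbf{Top}_{\mathcal C}$. *)

theory Defs
  imports
    "HOL-Analysis.Abstract_Topology"
    "HOL-Algebra.Complete_Lattice"
    "HOL-Library.FuncSet"
begin

section \<open>Categories, functors, natural transformations, adjunctions\<close>

record ('o, 'm) cat =
  Ob :: "'o set"
  Ar :: "'m set"
  Dom :: "'m \<Rightarrow> 'o"
  Cod :: "'m \<Rightarrow> 'o"
  Id :: "'o \<Rightarrow> 'm"
  Comp :: "'m \<Rightarrow> 'm \<Rightarrow> 'm"  \<comment> \<open>\<open>Comp C g f\<close> is \<open>g\<close> after \<open>f\<close>\<close>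

definition Hom :: "('o, 'm) cat \<Rightarrow> 'o \<Rightarrow> 'o \<Rightarrow> 'm set" where
  "Hom C A B = {f \<in> Ar C. Dom C f = A \<and> Cod C f = B}"

locale category =
  fixes C :: "('o, 'm) cat"
  assumes Dom_Ob: "f \<in> Ar C \<Longrightarrow> Dom C f \<in> Ob C"
    and Cod_Ob: "f \<in> Ar C \<Longrightarrow> Cod C f \<in> Ob C"
    and Id_Hom: "A \<in> Ob C \<Longrightarrow> Id C A \<in> Hom C A A"
    and Comp_Hom: "f \<in> Hom C A B \<Longrightarrow> g \<in> Hom C B D \<Longrightarrow> Comp C g f \<in> Hom C A D"
    and Comp_Id_left: "f \<in> Hom C A B \<Longrightarrow> Comp C (Id C B) f = f"
    and Comp_Id_right: "f \<in> Hom C A B \<Longrightarrow> Comp C f (Id C A) = f"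
    and Comp_assoc: "f \<in> Hom C A B \<Longrightarrow> g \<in> Hom C B D \<Longrightarrow> h \<in> Hom C D E \<Longrightarrow>
           Comp C h (Comp C g f) = Comp C (Comp C h g) f"

definition op_cat :: "('o, 'm) cat \<Rightarrow> ('o, 'm) cat" where
  "op_cat C = C\<lparr>Dom := Cod C, Cod := Dom C, Comp := (\<lambda>g f. Comp C f g)\<rparr>"

definition full_subcat :: "('o, 'm) cat \<Rightarrow> 'o set \<Rightarrow> ('o, 'm) cat" where
  "full_subcat C S =
     C\<lparr>Ob := Ob C \<inter> S, Ar := {f \<in> Ar C. Dom C f \<in> S \<and> Cod C f \<in> S}\<rparr>"

record ('o, 'm, 'p, 'n) ftor =
  FOb :: "'o \<Rightarrow> 'p"
  FAr :: "'m \<Rightarrow> 'n"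

definition id_ftor :: "('o, 'm, 'o, 'm) ftor" where
  "id_ftor = \<lparr>FOb = (\<lambda>A. A), FAr = (\<lambda>f. f)\<rparr>"

definition comp_ftor ::
  "('p, 'n, 'q, 'l) ftor \<Rightarrow> ('o, 'm, 'p, 'n) ftor \<Rightarrow> ('o, 'm, 'q, 'l) ftor" where
  "comp_ftor G F = \<lparr>FOb = FOb G \<circ> FOb F, FAr = FAr G \<circ> FAr F\<rparr>"

locale cat_functor = dom: category C + cod: category D
  for C :: "('o, 'm) cat" and D :: "('p, 'n) cat" +
  fixes F :: "('o, 'm, 'p, 'n) ftor"
  assumes FOb_Ob: "A \<in> Ob C \<Longrightarrow> FOb F A \<in> Ob D"
    and FAr_Hom: "f \<in> Hom C A B \<Longrightarrow> FAr F f \<in> Hom D (FOb F A) (FOb F B)"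
    and FAr_Id: "A \<in> Ob C \<Longrightarrow> FAr F (Id C A) = Id D (FOb F A)"
    and FAr_Comp: "f \<in> Hom C A B \<Longrightarrow> g \<in> Hom C B E \<Longrightarrow>
           FAr F (Comp C g f) = Comp D (FAr F g) (FAr F f)"

locale faithful_functor = cat_functor +
  assumes faithful: "f \<in> Hom C A B \<Longrightarrow> g \<in> Hom C A B \<Longrightarrow> FAr F f = FAr F g \<Longrightarrow> f = g"

locale nat_trans = F: cat_functor C D F + G: cat_functor C D G
  for C :: "('o, 'm) cat" and D :: "('p, 'n) cat" and F G +
  fixes \<alpha> :: "'o \<Rightarrow> 'n"
  assumes component_Hom: "A \<in> Ob C \<Longrightarrow> \<alpha> A \<in> Hom D (FOb F A) (FOb G A)"
    and natural: "f \<in> Hom C A B \<Longrightarrow>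
           Comp D (FAr G f) (\<alpha> A) = Comp D (\<alpha> B) (FAr F f)"

locale adjunction = left: cat_functor C D F + right: cat_functor D C G +
    unit: nat_trans C C id_ftor "comp_ftor G F" \<eta> +
    counit: nat_trans D D "comp_ftor F G" id_ftor \<epsilon>
  for C :: "('o, 'm) cat" and D :: "('p, 'n) cat" and F G \<eta> \<epsilon> +
  assumes triangle_left: "A \<in> Ob C \<Longrightarrow>
        Comp D (\<epsilon> (FOb F A)) (FAr F (\<eta> A)) = Id D (FOb F A)"
    and triangle_right: "B \<in> Ob D \<Longrightarrow>
        Comp C (FAr G (\<epsilon> B)) (\<eta> (FOb G B)) = Id C (FOb G B)"


section \<open>Sets, frames, topological spaces\<close>

text \<open>A morphism of structured sets is a function together with its source and target.
  Functions are extensional on the carrier of the source, so that equality of morphisms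
  is equality of functions on that carrier.\<close>

datatype ('o, 'x) mor = Mor (src: 'o) (fn: "'x \<Rightarrow> 'x") (tgt: 'o)

definition concrete_cat ::
  "'o set \<Rightarrow> ('o \<Rightarrow> 'x set) \<Rightarrow> ('o \<Rightarrow> 'o \<Rightarrow> ('x \<Rightarrow> 'x) set) \<Rightarrow> ('o, ('o, 'x) mor) cat" where
  "concrete_cat S car M =
     \<lparr>Ob = S,
      Ar = {Mor A f B | A f B. A \<in> S \<and> B \<in> S \<and> f \<in> extensional (car A) \<and> f \<in> M A B},
      Dom = src,
      Cod = tgt,
      Id = (\<lambda>A. Mor A (\<lambda>x\<in>car A. x) A),
      Comp = (\<lambda>g f. Mor (src f) (compose (car (src f)) (fn g) (fn f)) (tgt g))\<rparr>"

definition Set_cat :: "('x set, ('x set, 'x) mor) cat" where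
  "Set_cat = concrete_cat UNIV (\<lambda>A. A) (\<lambda>A B. A \<rightarrow> B)"

locale frame = complete_lattice +
  assumes meet_Sup_distrib: "x \<in> carrier L \<Longrightarrow> A \<subseteq> carrier L \<Longrightarrow>
    x \<sqinter> (\<Squnion>A) = \<Squnion>((\<lambda>a. x \<sqinter> a) ` A)"

definition frame_hom :: "'a gorder \<Rightarrow> 'b gorder \<Rightarrow> ('a \<Rightarrow> 'b) \<Rightarrow> bool" where
  "frame_hom L M f \<longleftrightarrow>
     f \<in> carrier L \<rightarrow> carrier M \<and>
     f \<top>\<^bsub>L\<^esub> = \<top>\<^bsub>M\<^esub> \<and>
     (\<forall>x\<in>carrier L. \<forall>y\<in>carrier L. f (x \<sqinter>\<^bsub>L\<^esub> y) = f x \<sqinter>\<^bsub>M\<^esub> f y) \<and>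
     (\<forall>A. A \<subseteq> carrier L \<longrightarrow> f (\<Squnion>\<^bsub>L\<^esub>A) = \<Squnion>\<^bsub>M\<^esub>(f ` A))"

definition frame_iso :: "'a gorder \<Rightarrow> 'b gorder \<Rightarrow> ('a \<Rightarrow> 'b) \<Rightarrow> bool" where
  "frame_iso L M f \<longleftrightarrow> frame_hom L M f \<and>
     (\<exists>g. frame_hom M L g \<and> (\<forall>x\<in>carrier L. g (f x) = x) \<and> (\<forall>y\<in>carrier M. f (g y) = y))"

definition Frm :: "('a gorder, ('a gorder, 'a) mor) cat" where
  "Frm = concrete_cat {L. frame L} carrier (\<lambda>L M. {f. frame_hom L M f})"

definition Top_cat :: "('x topology, ('x topology, 'x) mor) cat" where
  "Top_cat = concrete_cat UNIV topspace (\<lambda>X Y. {f. continuous_map X Y f})"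

definition underlying :: "('o \<Rightarrow> 'x set) \<Rightarrow> ('o, ('o, 'x) mor, 'x set, ('x set, 'x) mor) ftor" where
  "underlying car =
     \<lparr>FOb = car, FAr = (\<lambda>m. Mor (car (src m)) (fn m) (car (tgt m)))\<rparr>"

definition two :: "('x :: zero_neq_one) gorder" where
  "two = \<lparr>carrier = {0, 1}, eq = (=), le = (\<lambda>x y. x = y \<or> x = 0 \<and> y = 1)\<rparr>"

definition Sierpinski :: "('x :: zero_neq_one) topology" where
  "Sierpinski = topology (\<lambda>U. U \<in> {{}, {1}, {0, 1}})"


section \<open>Cartesian lifts along set-valued functors\<close>

text \<open>Throughout, \<open>U\<close> is a (faithful) functor from \<open>A\<close> to sets. The base set \<open>X\<close> of a
  cartesian lift may live in a different type than the values of \<open>U\<close>; for this reason the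
  functions \<open>f i\<close>, \<open>\<theta>\<close> and \<open>h\<close> appear here as plain functions on their source sets
  rather than as arrows of \<open>Set_cat\<close>.\<close>

definition is_lift ::
  "('o, 'm) cat \<Rightarrow> ('o, 'm, 'x set, ('x set, 'x) mor) ftor \<Rightarrow> 'o \<Rightarrow> 'o \<Rightarrow> ('x \<Rightarrow> 'x) \<Rightarrow> 'm \<Rightarrow> bool" where
  "is_lift A U D E h p \<longleftrightarrow> p \<in> Hom A D E \<and> (\<forall>x\<in>FOb U D. fn (FAr U p) x = h x)"

definition lifts ::
  "('o, 'm) cat \<Rightarrow> ('o, 'm, 'x set, ('x set, 'x) mor) ftor \<Rightarrow> 'o \<Rightarrow> 'o \<Rightarrow> ('x \<Rightarrow> 'x) \<Rightarrow> bool" where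
  "lifts A U D E h \<longleftrightarrow> (\<exists>p. is_lift A U D E h p)"

definition the_lift ::
  "('o, 'm) cat \<Rightarrow> ('o, 'm, 'x set, ('x set, 'x) mor) ftor \<Rightarrow> 'o \<Rightarrow> 'o \<Rightarrow> ('x \<Rightarrow> 'x) \<Rightarrow> 'm" where
  "the_lift A U D E h = (THE p. is_lift A U D E h p)"

text \<open>\<open>(Xb, \<theta>)\<close> is a cartesian lift of the family \<open>f i : X \<rightarrow> U E\<close>, \<open>i \<in> I\<close>.\<close>

definition cartesian_lift ::
  "('o, 'm) cat \<Rightarrow> ('o, 'm, 'x set, ('x set, 'x) mor) ftor \<Rightarrow> 'y set \<Rightarrow> 'o \<Rightarrow>
   'i set \<Rightarrow> ('i \<Rightarrow> 'y \<Rightarrow> 'x) \<Rightarrow> 'o \<times> ('x \<Rightarrow> 'y) \<Rightarrow> bool" where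
  "cartesian_lift A U X E I f = (\<lambda>(Xb, \<theta>).
     E \<in> Ob A \<and> (\<forall>i\<in>I. f i \<in> X \<rightarrow> FOb U E) \<and>
     Xb \<in> Ob A \<and> bij_betw \<theta> (FOb U Xb) X \<and>
     (\<forall>D\<in>Ob A. \<forall>h\<in>FOb U D \<rightarrow> FOb U Xb.
        lifts A U D Xb h \<longleftrightarrow> (\<forall>i\<in>I. lifts A U D E (\<lambda>x. f i (\<theta> (h x))))))"

definition cartesian_family ::
  "('o, 'm) cat \<Rightarrow> ('o, 'm, 'x set, ('x set, 'x) mor) ftor \<Rightarrow> 'o \<Rightarrow> 'o \<Rightarrow>
   'i set \<Rightarrow> ('i \<Rightarrow> 'm) \<Rightarrow> bool" where
  "cartesian_family A U D E I p \<longleftrightarrow>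
     (\<forall>i\<in>I. p i \<in> Hom A D E) \<and>
     cartesian_lift A U (FOb U D) E I (\<lambda>i. fn (FAr U (p i))) (D, \<lambda>x. x)"


section \<open>Represented and natural dual adjunctions\<close>

text \<open>Natural isomorphism of set-valued functors whose values may live in different types.\<close>

definition set_nat_iso ::
  "('o, 'm) cat \<Rightarrow> ('o, 'm, 'x set, ('x set, 'x) mor) ftor \<Rightarrow>
   ('o, 'm, 'y set, ('y set, 'y) mor) ftor \<Rightarrow> ('o \<Rightarrow> 'x \<Rightarrow> 'y) \<Rightarrow> bool" where
  "set_nat_iso C F G \<alpha> \<longleftrightarrow>
     cat_functor C Set_cat F \<and> cat_functor C Set_cat G \<and>
     (\<forall>A\<in>Ob C. bij_betw (\<alpha> A) (FOb F A) (FOb G A)) \<and>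
     (\<forall>A\<in>Ob C. \<forall>B\<in>Ob C. \<forall>f\<in>Hom C A B. \<forall>x\<in>FOb F A.
        \<alpha> B (fn (FAr F f) x) = fn (FAr G f) (\<alpha> A x))"

text \<open>The contravariant hom functor \<open>C(-, B)\<close>, as a functor on \<open>op_cat C\<close>.\<close>

definition hom_ftor :: "('o, 'm) cat \<Rightarrow> 'o \<Rightarrow> ('o, 'm, 'm set, ('m set, 'm) mor) ftor" where
  "hom_ftor C B =
     \<lparr>FOb = (\<lambda>A. Hom C A B),
      FAr = (\<lambda>f. Mor (Hom C (Cod C f) B) (\<lambda>g\<in>Hom C (Cod C f) B. Comp C g f) (Hom C (Dom C f) B))\<rparr>"

text \<open>A dual adjunction between \<open>A\<close> and \<open>B\<close>, with carrier functors \<open>U\<close> and \<open>V\<close>, is given by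
  functors \<open>F\<close> from \<open>A\<close> to \<open>op_cat B\<close> and \<open>G\<close> from \<open>op_cat B\<close> to \<open>A\<close>. Since
  \<open>op_cat\<close> changes neither the objects nor the arrows, \<open>F\<close> is also the opposite functor
  from \<open>op_cat A\<close> to \<open>B\<close>, which can be composed with \<open>V\<close>.\<close>

definition represented_by ::
  "('o, 'm) cat \<Rightarrow> ('o, 'm, 'x set, ('x set, 'x) mor) ftor \<Rightarrow>
   ('p, 'n) cat \<Rightarrow> ('p, 'n, 'y set, ('y set, 'y) mor) ftor \<Rightarrow>
   ('o, 'm, 'p, 'n) ftor \<Rightarrow> ('p, 'n, 'o, 'm) ftor \<Rightarrow> 'o \<Rightarrow> 'p \<Rightarrow>
   ('o \<Rightarrow> 'y \<Rightarrow> 'm) \<Rightarrow> ('p \<Rightarrow> 'x \<Rightarrow> 'n) \<Rightarrow> bool" where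
  "represented_by A U B V F G D E \<phi> \<gamma> \<longleftrightarrow>
     D \<in> Ob A \<and> E \<in> Ob B \<and>
     set_nat_iso (op_cat A) (comp_ftor V F) (hom_ftor A D) \<phi> \<and>
     set_nat_iso (op_cat B) (comp_ftor U G) (hom_ftor B E) \<gamma>"

definition natural_dual_adjunction ::
  "('o, 'm) cat \<Rightarrow> ('o, 'm, 'x set, ('x set, 'x) mor) ftor \<Rightarrow>
   ('p, 'n) cat \<Rightarrow> ('p, 'n, 'y set, ('y set, 'y) mor) ftor \<Rightarrow>
   ('o, 'm, 'p, 'n) ftor \<Rightarrow> ('p, 'n, 'o, 'm) ftor \<Rightarrow> ('o \<Rightarrow> 'm) \<Rightarrow> ('p \<Rightarrow> 'n) \<Rightarrow> 'o \<Rightarrow> 'p \<Rightarrow>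
   ('o \<Rightarrow> 'y \<Rightarrow> 'm) \<Rightarrow> ('p \<Rightarrow> 'x \<Rightarrow> 'n) \<Rightarrow> bool" where
  "natural_dual_adjunction A U B V F G \<eta> \<sigma> D E \<phi> \<gamma> \<longleftrightarrow>
     (\<forall>C\<in>Ob A. cartesian_family B V (FOb F C) E
        (FOb U C) (\<lambda>c. \<gamma> (FOb F C) (fn (FAr U (\<eta> C)) c))) \<and>
     (\<forall>X\<in>Ob B. cartesian_family A U (FOb G X) D
        (FOb V X) (\<lambda>x. \<phi> (FOb G X) (fn (FAr V (\<sigma> X)) x)))"


section \<open>PFC- and SFC-categories\<close>

text \<open>Spaces have their points in the type \<open>'m\<close> of arrows of the category, so that hom-sets
  can be point sets of spaces. The class constraint provides two distinct elements
  \<open>0\<close> and \<open>1\<close> of \<open>'m\<close>, the common underlying set of \<open>two\<close> and \<open>Sierpinski\<close>.\<close>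

record ('o, 'm, 'a) pfc =
  Cat :: "('o, 'm) cat"
  Oftor :: "('o, 'm, 'a gorder, ('a gorder, 'a) mor) ftor"
  Two :: 'o
  Iota :: "'a \<Rightarrow> 'm"

locale PFC =
  faithful_functor "Cat P" Frm "Oftor P"
  for P :: "('o, 'm :: zero_neq_one, 'a) pfc" +
  assumes Two_Ob: "Two P \<in> Ob (Cat P)"
    and Iota_iso: "frame_iso (FOb (Oftor P) (Two P)) two (Iota P)"

definition Ocar ::
  "('o, 'm :: zero_neq_one, 'a) pfc \<Rightarrow> ('o, 'm, 'a set, ('a set, 'a) mor) ftor" where
  "Ocar P = comp_ftor (underlying carrier) (Oftor P)"

definition chi ::
  "('o, 'm :: zero_neq_one, 'a) pfc \<Rightarrow> 'm \<Rightarrow> ('m topology, 'm) mor \<Rightarrow> 'a" where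
  "chi P x g = inv_into (FOb (Ocar P) (Two P)) (Iota P) (fn g x)"

definition Omega_lift ::
  "('o, 'm :: zero_neq_one, 'a) pfc \<Rightarrow> 'm topology \<Rightarrow>
   'o \<times> ('a \<Rightarrow> ('m topology, 'm) mor) \<Rightarrow> bool" where
  "Omega_lift P X =
     cartesian_lift (Cat P) (Ocar P) (Hom Top_cat X Sierpinski) (Two P) (topspace X) (chi P)"

definition Top_C ::
  "('o, 'm :: zero_neq_one, 'a) pfc \<Rightarrow> ('m topology, ('m topology, 'm) mor) cat" where
  "Top_C P = full_subcat Top_cat {X. \<exists>L. Omega_lift P X L}"

definition pt_space :: "('o, 'm :: zero_neq_one, 'a) pfc \<Rightarrow> 'o \<Rightarrow> 'm topology" where
  "pt_space P C = topology (\<lambda>U. \<exists>a\<in>FOb (Ocar P) C.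
     U = {f \<in> Hom (Cat P) C (Two P). Iota P (fn (FAr (Ocar P) f) a) = 1})"

locale SFC = PFC +
  assumes Sierpinski_Top_C: "Sierpinski \<in> Ob (Top_C P)"
    and pt_space_Top_C: "C \<in> Ob (Cat P) \<Longrightarrow> pt_space P C \<in> Ob (Top_C P)"

definition lift_choice ::
  "('o, 'm :: zero_neq_one, 'a) pfc \<Rightarrow>
   ('m topology \<Rightarrow> 'o \<times> ('a \<Rightarrow> ('m topology, 'm) mor)) \<Rightarrow> bool" where
  "lift_choice P \<Lambda> \<longleftrightarrow> (\<forall>X\<in>Ob (Top_C P). Omega_lift P X (\<Lambda> X))"

text \<open>In what follows \<open>\<Lambda>\<close> is the fixed choice of lifts, \<open>\<Lambda> X = (\<Omega> X, \<theta>\<^sub>X)\<close>.\<close>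

definition Omega_ob ::
  "('m topology \<Rightarrow> 'o \<times> ('a \<Rightarrow> ('m topology, 'm) mor)) \<Rightarrow> 'm topology \<Rightarrow> 'o" where
  "Omega_ob \<Lambda> X = fst (\<Lambda> X)"

definition theta ::
  "('m topology \<Rightarrow> 'o \<times> ('a \<Rightarrow> ('m topology, 'm) mor)) \<Rightarrow>
   'm topology \<Rightarrow> 'a \<Rightarrow> ('m topology, 'm) mor" where
  "theta \<Lambda> X = snd (\<Lambda> X)"

definition theta_inv ::
  "('o, 'm :: zero_neq_one, 'a) pfc \<Rightarrow> ('m topology \<Rightarrow> 'o \<times> ('a \<Rightarrow> ('m topology, 'm) mor)) \<Rightarrow>
   'm topology \<Rightarrow> ('m topology, 'm) mor \<Rightarrow> 'a" where
  "theta_inv P \<Lambda> X = inv_into (FOb (Ocar P) (Omega_ob \<Lambda> X)) (theta \<Lambda> X)"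

definition chi_bar ::
  "('o, 'm :: zero_neq_one, 'a) pfc \<Rightarrow> ('m topology \<Rightarrow> 'o \<times> ('a \<Rightarrow> ('m topology, 'm) mor)) \<Rightarrow>
   'm topology \<Rightarrow> 'm \<Rightarrow> 'm" where
  "chi_bar P \<Lambda> X x =
     the_lift (Cat P) (Ocar P) (Omega_ob \<Lambda> X) (Two P) (\<lambda>b. chi P x (theta \<Lambda> X b))"

text \<open>The functor from \<open>Cat P\<close> to the opposite of \<open>Top_C P\<close>.\<close>

definition pt_ftor ::
  "('o, 'm :: zero_neq_one, 'a) pfc \<Rightarrow> ('o, 'm, 'm topology, ('m topology, 'm) mor) ftor" where
  "pt_ftor P =
     \<lparr>FOb = pt_space P,
      FAr = (\<lambda>f. Mor (pt_space P (Cod (Cat P) f))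
                     (\<lambda>g\<in>Hom (Cat P) (Cod (Cat P) f) (Two P). Comp (Cat P) g f)
                     (pt_space P (Dom (Cat P) f)))\<rparr>"

text \<open>The function \<open>|\<O> \<Omega> Y| \<rightarrow> |\<O> \<Omega> X|\<close> whose lift is \<open>\<Omega> f\<close>, for
  continuous \<open>f : X \<rightarrow> Y\<close>.\<close>

definition Omega_fun ::
  "('o, 'm :: zero_neq_one, 'a) pfc \<Rightarrow> ('m topology \<Rightarrow> 'o \<times> ('a \<Rightarrow> ('m topology, 'm) mor)) \<Rightarrow>
   ('m topology, 'm) mor \<Rightarrow> 'a \<Rightarrow> 'a" where
  "Omega_fun P \<Lambda> f b = theta_inv P \<Lambda> (src f) (Comp Top_cat (theta \<Lambda> (tgt f) b) f)"

definition Omega_ftor ::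
  "('o, 'm :: zero_neq_one, 'a) pfc \<Rightarrow> ('m topology \<Rightarrow> 'o \<times> ('a \<Rightarrow> ('m topology, 'm) mor)) \<Rightarrow>
   ('m topology, ('m topology, 'm) mor, 'o, 'm) ftor" where
  "Omega_ftor P \<Lambda> =
     \<lparr>FOb = Omega_ob \<Lambda>,
      FAr = (\<lambda>f. the_lift (Cat P) (Ocar P) (Omega_ob \<Lambda> (tgt f)) (Omega_ob \<Lambda> (src f))
                   (Omega_fun P \<Lambda> f))\<rparr>"

definition sigma ::
  "('o, 'm :: zero_neq_one, 'a) pfc \<Rightarrow> ('m topology \<Rightarrow> 'o \<times> ('a \<Rightarrow> ('m topology, 'm) mor)) \<Rightarrow>
   'm topology \<Rightarrow> ('m topology, 'm) mor" where
  "sigma P \<Lambda> X =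
     Mor X (\<lambda>x\<in>topspace X. chi_bar P \<Lambda> X x) (pt_space P (Omega_ob \<Lambda> X))"

text \<open>The continuous map \<open>f \<mapsto> \<iota> (\<O> f a)\<close> from \<open>pt C\<close> to the Sierpinski space.\<close>

definition ev_map ::
  "('o, 'm :: zero_neq_one, 'a) pfc \<Rightarrow> 'o \<Rightarrow> 'a \<Rightarrow> ('m topology, 'm) mor" where
  "ev_map P C a = Mor (pt_space P C)
     (\<lambda>f\<in>Hom (Cat P) C (Two P). Iota P (fn (FAr (Ocar P) f) a)) Sierpinski"

definition eta_fun ::
  "('o, 'm :: zero_neq_one, 'a) pfc \<Rightarrow> ('m topology \<Rightarrow> 'o \<times> ('a \<Rightarrow> ('m topology, 'm) mor)) \<Rightarrow>
   'o \<Rightarrow> 'a \<Rightarrow> 'a" where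
  "eta_fun P \<Lambda> C a = theta_inv P \<Lambda> (pt_space P C) (ev_map P C a)"

definition eta ::
  "('o, 'm :: zero_neq_one, 'a) pfc \<Rightarrow> ('m topology \<Rightarrow> 'o \<times> ('a \<Rightarrow> ('m topology, 'm) mor)) \<Rightarrow>
   'o \<Rightarrow> 'm" where
  "eta P \<Lambda> C =
     the_lift (Cat P) (Ocar P) C (Omega_ob \<Lambda> (pt_space P C)) (eta_fun P \<Lambda> C)"


section \<open>Well-definedness\<close>

lemma Hom_concrete_cat:
  "m \<in> Hom (concrete_cat S car M) A B \<longleftrightarrow>
     (\<exists>f. m = Mor A f B \<and> A \<in> S \<and> B \<in> S \<and> f \<in> extensional (car A) \<and> f \<in> M A B)"
  by (auto simp: concrete_cat_def Hom_def)

lemma Comp_concrete_cat: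
  "Comp (concrete_cat S car M) (Mor B g D) (Mor A f B') = Mor A (compose (car A) g f) D"
  by (simp add: concrete_cat_def)

lemma Id_concrete_cat: "Id (concrete_cat S car M) A = Mor A (\<lambda>x\<in>car A. x) A"
  by (simp add: concrete_cat_def)

lemma category_concrete_cat:
  assumes funM: "\<And>A B f. A \<in> S \<Longrightarrow> B \<in> S \<Longrightarrow> f \<in> M A B \<Longrightarrow> f \<in> car A \<rightarrow> car B"
    and idM: "\<And>A. A \<in> S \<Longrightarrow> (\<lambda>x\<in>car A. x) \<in> M A A"
    and compM: "\<And>A B D f g. A \<in> S \<Longrightarrow> B \<in> S \<Longrightarrow> D \<in> S \<Longrightarrow> f \<in> M A B \<Longrightarrow> g \<in> M B D \<Longrightarrow>
      compose (car A) g f \<in> M A D"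
  shows "category (concrete_cat S car M)"
proof
  fix A B D E f g h
  let ?C = "concrete_cat S car M"
  show "Dom ?C f \<in> Ob ?C" "Cod ?C f \<in> Ob ?C" if "f \<in> Ar ?C"
    using that by (auto simp: concrete_cat_def)
  show "Id ?C A \<in> Hom ?C A A" if "A \<in> Ob ?C"
    using that idM by (simp add: Hom_concrete_cat Id_concrete_cat) (simp add: concrete_cat_def)
  assume "f \<in> Hom ?C A B"
  then obtain f' where f: "f = Mor A f' B" "A \<in> S" "B \<in> S" "f' \<in> extensional (car A)" "f' \<in> M A B"
    by (auto simp: Hom_concrete_cat)
  have f': "f' \<in> car A \<rightarrow> car B" using funM f by blast
  show "Comp ?C (Id ?C B) f = f"
    using f f' by (auto simp: Id_concrete_cat Comp_concrete_cat Id_compose)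
  show "Comp ?C f (Id ?C A) = f"
    using f f' by (auto simp: Id_concrete_cat Comp_concrete_cat compose_Id)
  assume "g \<in> Hom ?C B D"
  then obtain g' where g: "g = Mor B g' D" "D \<in> S" "g' \<in> extensional (car B)" "g' \<in> M B D"
    by (auto simp: Hom_concrete_cat)
  show "Comp ?C g f \<in> Hom ?C A D"
    using f g compM by (auto simp: Hom_concrete_cat Comp_concrete_cat)
  assume "h \<in> Hom ?C D E"
  then obtain h' where h: "h = Mor D h' E" by (auto simp: Hom_concrete_cat)
  show "Comp ?C h (Comp ?C g f) = Comp ?C (Comp ?C h g) f"
    using f' by (simp add: f g h Comp_concrete_cat compose_assoc)
qed

lemma category_Set_cat: "category Set_cat"
  unfolding Set_cat_def by (rule category_concrete_cat) (auto simp: compose_def)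

lemma category_Top_cat: "category Top_cat"
  unfolding Top_cat_def
proof (rule category_concrete_cat)
  fix A B D :: "'a topology" and f g
  assume "f \<in> {f. continuous_map A B f}" "g \<in> {f. continuous_map B D f}"
  then have "continuous_map A D (g \<circ> f)"
    by (simp add: continuous_map_compose)
  then have "continuous_map A D (compose (topspace A) g f)"
    by (rule continuous_map_eq) (simp add: compose_eq)
  then show "compose (topspace A) g f \<in> {f. continuous_map A D f}"
    by simp
next
  fix A :: "'a topology"
  have "continuous_map A A (\<lambda>x. x)" by simp
  then have "continuous_map A A (\<lambda>x\<in>topspace A. x)"
    by (rule continuous_map_eq) simp
  then show "(\<lambda>x\<in>topspace A. x) \<in> {f. continuous_map A A f}"
    by simp
qed (simp add: continuous_map_def)

lemma frame_hom_compose: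
  assumes L: "frame L" and f: "frame_hom L M f" and g: "frame_hom M N g"
  shows "frame_hom L N (compose (carrier L) g f)"
proof -
  interpret L: frame L by fact
  have fP: "f \<in> carrier L \<rightarrow> carrier M" using f by (simp add: frame_hom_def)
  have gP: "g \<in> carrier M \<rightarrow> carrier N" using g by (simp add: frame_hom_def)
  have "compose (carrier L) g f (\<Squnion>\<^bsub>L\<^esub>S) = \<Squnion>\<^bsub>N\<^esub>(compose (carrier L) g f ` S)"
    if S: "S \<subseteq> carrier L" for S
  proof -
    have im: "compose (carrier L) g f ` S = g ` f ` S"
      unfolding image_image using S by (intro image_cong) (auto simp: compose_eq)
    have "f ` S \<subseteq> carrier M" using S fP by blast
    then show ?thesis
      unfolding im using f g S by (simp add: frame_hom_def compose_eq)
  qed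
  moreover have "compose (carrier L) g f (x \<sqinter>\<^bsub>L\<^esub> y) =
      compose (carrier L) g f x \<sqinter>\<^bsub>N\<^esub> compose (carrier L) g f y"
    if x: "x \<in> carrier L" and y: "y \<in> carrier L" for x y
  proof -
    have "f x \<in> carrier M" "f y \<in> carrier M" using x y fP by auto
    then show ?thesis
      using f g x y by (simp add: frame_hom_def compose_eq)
  qed
  moreover have "compose (carrier L) g f \<top>\<^bsub>L\<^esub> = \<top>\<^bsub>N\<^esub>"
    using f g by (simp add: frame_hom_def compose_eq)
  ultimately show ?thesis
    using funcset_compose[OF fP gP] by (simp add: frame_hom_def)
qed

lemma category_Frm: "category Frm"
  unfolding Frm_def
proof (rule category_concrete_cat)
  fix A :: "'a gorder"
  assume "A \<in> {L. frame L}"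
  then interpret frame A by simp
  have "(\<lambda>x\<in>carrier A. x) ` B = B" if "B \<subseteq> carrier A" for B
    using that image_cong[of B B "\<lambda>x\<in>carrier A. x" id] by auto
  then show "(\<lambda>x\<in>carrier A. x) \<in> {f. frame_hom A A f}"
    by (simp add: frame_hom_def)
next
  fix A B D :: "'a gorder" and f g
  assume "A \<in> {L. frame L}" "f \<in> {f. frame_hom A B f}" "g \<in> {f. frame_hom B D f}"
  then show "compose (carrier A) g f \<in> {f. frame_hom A D f}"
    by (simp add: frame_hom_compose)
qed (simp add: frame_hom_def)

lemma partial_order_two: "partial_order (two :: 'x :: zero_neq_one gorder)"
  by standard (auto simp: two_def)

lemma complete_lattice_two: "complete_lattice (two :: 'x :: zero_neq_one gorder)"
proof -
  let ?T = "two :: 'x gorder"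
  interpret partial_order ?T by (rule partial_order_two)
  show ?thesis
  proof
    fix A assume A: "A \<subseteq> carrier ?T"
    have "least ?T (if 1 \<in> A then 1 else 0) (Upper ?T A)"
      using A by (auto simp: least_def Upper_def two_def)
    then show "\<exists>s. least ?T s (Upper ?T A)" ..
    have "greatest ?T (if 0 \<in> A then 0 else 1) (Lower ?T A)"
      using A by (auto simp: greatest_def Lower_def two_def)
    then show "\<exists>s. greatest ?T s (Lower ?T A)" ..
  qed
qed

lemma Sup_two:
  fixes A :: "'x :: zero_neq_one set"
  assumes A: "A \<subseteq> {0, 1}"
  shows "\<Squnion>\<^bsub>two\<^esub>A = (if 1 \<in> A then 1 else 0)"
proof -
  interpret complete_lattice "two :: 'x gorder" by (rule complete_lattice_two)
  have "least two (if 1 \<in> A then 1 else 0) (Upper two A)"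
    using A by (auto simp: least_def Upper_def two_def)
  moreover have "least two (\<Squnion>\<^bsub>two\<^esub>A) (Upper two A)"
    using A by (intro sup_lub) (simp add: two_def)
  ultimately show ?thesis
    by (metis least_unique)
qed

lemma Inf_two:
  fixes A :: "'x :: zero_neq_one set"
  assumes A: "A \<subseteq> {0, 1}"
  shows "\<Sqinter>\<^bsub>two\<^esub>A = (if 0 \<in> A then 0 else 1)"
proof -
  interpret complete_lattice "two :: 'x gorder" by (rule complete_lattice_two)
  have "greatest two (if 0 \<in> A then 0 else 1) (Lower two A)"
    using A by (auto simp: greatest_def Lower_def two_def)
  moreover have "greatest two (\<Sqinter>\<^bsub>two\<^esub>A) (Lower two A)"
    using A by (intro inf_glb) (simp add: two_def)
  ultimately show ?thesis
    by (metis greatest_unique)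
qed

lemma meet_two:
  fixes x y :: "'x :: zero_neq_one"
  assumes "x \<in> {0, 1}" "y \<in> {0, 1}"
  shows "x \<sqinter>\<^bsub>two\<^esub> y = (if x = 1 \<and> y = 1 then 1 else 0)"
  using assms by (auto simp: meet_def Inf_two)

lemma top_two: "\<top>\<^bsub>two\<^esub> = (1 :: 'x :: zero_neq_one)"
proof -
  interpret complete_lattice "two :: 'x gorder" by (rule complete_lattice_two)
  have "1 \<sqsubseteq>\<^bsub>two\<^esub> (\<top>\<^bsub>two\<^esub> :: 'x)" by (rule top_higher) (simp add: two_def)
  then show ?thesis by (auto simp: two_def)
qed

lemma frame_two: "frame (two :: 'x :: zero_neq_one gorder)"
proof -
  let ?T = "two :: 'x gorder"
  interpret complete_lattice ?T by (rule complete_lattice_two)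
  show ?thesis
  proof
    fix x :: 'x and A
    assume "x \<in> carrier ?T" and "A \<subseteq> carrier ?T"
    then have x: "x \<in> {0, 1}" and A: "A \<subseteq> {0, 1}" by (simp_all add: two_def)
    have "(\<lambda>a. x \<sqinter>\<^bsub>?T\<^esub> a) ` A = (\<lambda>a. if x = 1 \<and> a = 1 then 1 else 0) ` A"
      using x A by (intro image_cong refl meet_two) auto
    moreover have "\<Squnion>\<^bsub>?T\<^esub>((\<lambda>a. if x = 1 \<and> a = 1 then 1 else 0) ` A) =
        (if 1 \<in> (\<lambda>a. if x = 1 \<and> a = 1 then 1 else 0 :: 'x) ` A then 1 else 0)"
      by (rule Sup_two) auto
    moreover have "1 \<in> (\<lambda>a. if x = 1 \<and> a = 1 then 1 else 0 :: 'x) ` A \<longleftrightarrow> x = 1 \<and> 1 \<in> A"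
      by (auto simp: image_iff)
    moreover have "x \<sqinter>\<^bsub>?T\<^esub> \<Squnion>\<^bsub>?T\<^esub>A = (if x = 1 \<and> 1 \<in> A then 1 else 0)"
      using meet_two[OF x, of "\<Squnion>\<^bsub>?T\<^esub>A"] Sup_two[OF A] by auto
    ultimately show "x \<sqinter>\<^bsub>?T\<^esub> \<Squnion>\<^bsub>?T\<^esub>A = \<Squnion>\<^bsub>?T\<^esub>((\<lambda>a. x \<sqinter>\<^bsub>?T\<^esub> a) ` A)"
      by simp
  qed
qed

lemma openin_Sierpinski:
  "openin (Sierpinski :: 'x :: zero_neq_one topology) U \<longleftrightarrow> U \<in> {{}, {1}, {0, 1}}"
proof -
  have "istopology (\<lambda>U :: 'x set. U \<in> {{}, {1}, {0, 1}})"
    unfolding istopology_def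
  proof (intro conjI allI impI)
    fix S T :: "'x set"
    assume "S \<in> {{}, {1}, {0, 1}}" "T \<in> {{}, {1}, {0, 1}}"
    then show "S \<inter> T \<in> {{}, {1}, {0, 1}}" by auto
  next
    fix K :: "'x set set"
    assume K: "\<forall>U\<in>K. U \<in> {{}, {1}, {0, 1}}"
    show "\<Union>K \<in> {{}, {1}, {0, 1}}"
    proof (cases "{0, 1} \<in> K")
      case True
      then have "\<Union>K = {0, 1}" using K by blast
      then show ?thesis by simp
    next
      case False
      then have "\<Union>K \<subseteq> {1}" using K by blast
      then show ?thesis by blast
    qed
  qed
  then show ?thesis
    by (simp add: Sierpinski_def topology_inverse')
qed

context PFC
begin

lemma frame_hom_eval:
  assumes f: "f \<in> Hom (Cat P) C (Two P)"
  shows "frame_hom (FOb (Oftor P) C) two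
    (compose (carrier (FOb (Oftor P) C)) (Iota P) (fn (FAr (Ocar P) f)))"
proof (rule frame_hom_compose)
  have *: "FAr (Oftor P) f \<in> Hom Frm (FOb (Oftor P) C) (FOb (Oftor P) (Two P))"
    using FAr_Hom[OF f] .
  then show "frame (FOb (Oftor P) C)"
    by (auto simp: Frm_def Hom_concrete_cat)
  show "frame_hom (FOb (Oftor P) C) (FOb (Oftor P) (Two P)) (fn (FAr (Ocar P) f))"
    using * by (auto simp: Frm_def Hom_concrete_cat Ocar_def comp_ftor_def underlying_def)
  show "frame_hom (FOb (Oftor P) (Two P)) two (Iota P)"
    using Iota_iso by (simp add: frame_iso_def)
qed

lemma openin_pt_space:
  assumes C: "C \<in> Ob (Cat P)"
  shows "openin (pt_space P C) U \<longleftrightarrow> (\<exists>a\<in>FOb (Ocar P) C.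
     U = {f \<in> Hom (Cat P) C (Two P). Iota P (fn (FAr (Ocar P) f) a) = 1})"
proof -
  define L where "L = FOb (Oftor P) C"
  define e where "e f a = Iota P (fn (FAr (Ocar P) f) a)" for f a
  define H where "H = Hom (Cat P) C (Two P)"
  have L: "FOb (Ocar P) C = carrier L"
    by (simp add: Ocar_def comp_ftor_def underlying_def L_def)
  have "frame L"
    using FOb_Ob[OF C] by (simp add: Frm_def concrete_cat_def L_def)
  then interpret L: frame L .
  have hom: "frame_hom L two (\<lambda>a\<in>carrier L. e f a)" if "f \<in> H" for f
    using frame_hom_eval[of f C] that by (simp add: H_def L_def compose_def e_def)
  have e_in: "e f a \<in> {0, 1}" if "f \<in> H" "a \<in> carrier L" for f a
    using hom[OF that(1)] that(2) by (auto simp: frame_hom_def two_def Pi_iff)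
  have e_meet: "e f (a \<sqinter>\<^bsub>L\<^esub> b) = 1 \<longleftrightarrow> e f a = 1 \<and> e f b = 1"
    if "f \<in> H" "a \<in> carrier L" "b \<in> carrier L" for f a b
  proof -
    have "e f (a \<sqinter>\<^bsub>L\<^esub> b) = e f a \<sqinter>\<^bsub>two\<^esub> e f b"
      using hom[OF that(1)] that(2,3) by (simp add: frame_hom_def)
    then show ?thesis
      using meet_two[OF e_in[OF that(1,2)] e_in[OF that(1,3)]] by simp
  qed
  have e_Sup: "e f (\<Squnion>\<^bsub>L\<^esub>A) = 1 \<longleftrightarrow> (\<exists>a\<in>A. e f a = 1)"
    if "f \<in> H" "A \<subseteq> carrier L" for f A
  proof -
    have "(\<lambda>a\<in>carrier L. e f a) ` A = e f ` A"
      using that(2) by (intro image_cong) auto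
    then have "e f (\<Squnion>\<^bsub>L\<^esub>A) = \<Squnion>\<^bsub>two\<^esub>(e f ` A)"
      using hom[OF that(1)] that(2) by (simp add: frame_hom_def)
    also have "\<dots> = (if 1 \<in> e f ` A then 1 else 0)"
      using e_in[OF that(1)] that(2) by (intro Sup_two) blast
    finally show ?thesis by force
  qed
  have "istopology (\<lambda>U. \<exists>a\<in>carrier L. U = {f \<in> H. e f a = 1})"
    unfolding istopology_def
  proof (intro conjI allI impI)
    fix S T
    assume "\<exists>a\<in>carrier L. S = {f \<in> H. e f a = 1}" "\<exists>a\<in>carrier L. T = {f \<in> H. e f a = 1}"
    then obtain a b where ab: "a \<in> carrier L" "b \<in> carrier L"
      and "S = {f \<in> H. e f a = 1}" "T = {f \<in> H. e f b = 1}" by blast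
    then have "S \<inter> T = {f \<in> H. e f (a \<sqinter>\<^bsub>L\<^esub> b) = 1}"
      using e_meet by blast
    then show "\<exists>a\<in>carrier L. S \<inter> T = {f \<in> H. e f a = 1}"
      using ab by (intro bexI[of _ "a \<sqinter>\<^bsub>L\<^esub> b"]) auto
  next
    fix K
    assume K: "\<forall>U\<in>K. \<exists>a\<in>carrier L. U = {f \<in> H. e f a = 1}"
    define A where "A = {a \<in> carrier L. {f \<in> H. e f a = 1} \<in> K}"
    have A: "A \<subseteq> carrier L" by (auto simp: A_def)
    have "K = (\<lambda>a. {f \<in> H. e f a = 1}) ` A"
      using K by (auto simp: A_def)
    then have "\<Union>K = {f \<in> H. \<exists>a\<in>A. e f a = 1}"
      by auto
    also have "\<dots> = {f \<in> H. e f (\<Squnion>\<^bsub>L\<^esub>A) = 1}"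
      by (rule Collect_cong) (use e_Sup[OF _ A] in auto)
    finally show "\<exists>a\<in>carrier L. \<Union>K = {f \<in> H. e f a = 1}"
      using A by (intro bexI[of _ "\<Squnion>\<^bsub>L\<^esub>A"]) auto
  qed
  then show ?thesis
    by (simp add: pt_space_def topology_inverse' L e_def H_def)
qed

lemma topspace_pt_space:
  assumes C: "C \<in> Ob (Cat P)"
  shows "topspace (pt_space P C) = Hom (Cat P) C (Two P)"
proof
  show "topspace (pt_space P C) \<subseteq> Hom (Cat P) C (Two P)"
    using openin_topspace[of "pt_space P C"] unfolding openin_pt_space[OF C] by auto
  define L where "L = FOb (Oftor P) C"
  have "frame L"
    using FOb_Ob[OF C] by (simp add: Frm_def concrete_cat_def L_def)
  then interpret L: frame L .
  have "Iota P (fn (FAr (Ocar P) f) \<top>\<^bsub>L\<^esub>) = 1" if "f \<in> Hom (Cat P) C (Two P)" for f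
    using frame_hom_eval[OF that] by (simp add: frame_hom_def top_two compose_eq flip: L_def)
  then have "Hom (Cat P) C (Two P) =
      {f \<in> Hom (Cat P) C (Two P). Iota P (fn (FAr (Ocar P) f) \<top>\<^bsub>L\<^esub>) = 1}"
    by blast
  moreover have "\<top>\<^bsub>L\<^esub> \<in> FOb (Ocar P) C"
    by (simp add: Ocar_def comp_ftor_def underlying_def flip: L_def)
  ultimately have "openin (pt_space P C) (Hom (Cat P) C (Two P))"
    unfolding openin_pt_space[OF C] by blast
  then show "Hom (Cat P) C (Two P) \<subseteq> topspace (pt_space P C)"
    by (rule openin_subset)
qed

end

end

theory Submission
  imports Defs
begin

text \<open>
  Write \<open>U C\<close> for the underlying set of the frame \<open>\<O> C\<close>. Faithfulness
  reduces the theorem to equations between functions: arrows of \<open>\<C>\<close> with the same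
  action on \<open>U\<close> are equal (\<open>set_functor.arrow_eqI\<close>), so lifts are unique and \<open>the_lift\<close> is a
  lift whenever there is one. For arrows into \<open>\<Omega> X\<close> it even suffices to compare the
  actions after the bijection \<open>\<theta>\<^sub>X\<close> onto the continuous maps from \<open>X\<close> to the Sierpinski
  space (\<open>arrow_to_Omega_eqI\<close>).

  A function into \<open>U (\<Omega> X)\<close> lifts iff its composites with all \<open>\<chi>\<^sub>x \<circ> \<theta>\<^sub>X\<close> lift. For
  \<open>Omega_fun\<close> of \<open>f : X \<rightarrow> Y\<close> this composite is \<open>\<chi>\<^bsub>f x\<^esub> \<circ> \<theta>\<^sub>Y\<close>, lifted by
  \<open>chi_bar\<close> of \<open>Y\<close> at \<open>f x\<close> (\<open>is_lift_Omega\<close>); for \<open>eta_fun\<close> and a point \<open>f\<close> of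
  \<open>pt C\<close> it is the action of \<open>f\<close> itself (\<open>is_lift_eta\<close>). Dually, a function \<open>h\<close> into
  \<open>pt C\<close> is continuous iff all sets \<open>{x. \<iota> (\<O> (h x) a) = 1}\<close> are open
  (\<open>continuous_map_pt_space_iff\<close>), which gives continuity of \<open>sigma\<close> and of \<open>pt f\<close>.

  Under these identifications \<open>\<eta>\<close> sends \<open>a\<close> to evaluation at \<open>a\<close>, \<open>\<sigma>\<close> sends \<open>x\<close> to
  evaluation at \<open>x\<close>, and \<open>\<Omega>\<close> and \<open>pt\<close> act by precomposition. Functoriality, the naturality
  squares and the triangle identities are then pointwise calculations. Representability
  restates the action of \<open>pt\<close> and \<open>\<Omega>\<close> on morphisms. The first family in the definition of
  naturality consists of the maps \<open>ev_map P C a\<close>, which are cartesian because the opens of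
  \<open>pt C\<close> are exactly the sets that they classify (\<open>cartesian_ev_map\<close>); the second consists of the
  arrows \<open>chi_bar P \<Lambda> X x\<close>, which are cartesian by the choice of \<open>\<Omega> X\<close>
  (\<open>cartesian_chi_bar\<close>).
\<close>

section \<open>Opposite categories, full subcategories and hom functors\<close>

lemma op_cat_simps [simp]:
  "Ob (op_cat C) = Ob C" "Ar (op_cat C) = Ar C" "Dom (op_cat C) = Cod C" "Cod (op_cat C) = Dom C"
  "Id (op_cat C) = Id C" "Comp (op_cat C) g f = Comp C f g" "Hom (op_cat C) A B = Hom C B A"
  by (auto simp: op_cat_def Hom_def)

lemma op_cat_op_cat [simp]: "op_cat (op_cat C) = C"
  by (simp add: op_cat_def)

lemma category_op_cat:
  assumes "category C"
  shows "category (op_cat C)"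
proof -
  interpret category C by fact
  show ?thesis
    by unfold_locales
      (auto simp: Dom_Ob Cod_Ob Id_Hom Comp_Hom Comp_Id_left Comp_Id_right intro: Comp_assoc[symmetric])
qed

lemma cat_functor_op_cat:
  assumes "cat_functor C D F"
  shows "cat_functor (op_cat C) (op_cat D) F"
proof -
  interpret cat_functor C D F by fact
  interpret op_dom: category "op_cat C" by (rule category_op_cat) unfold_locales
  interpret op_cod: category "op_cat D" by (rule category_op_cat) unfold_locales
  show ?thesis
    by unfold_locales (auto simp: FOb_Ob FAr_Hom FAr_Id FAr_Comp)
qed

lemma cat_functor_comp_ftor:
  assumes "cat_functor C D F" and "cat_functor D E G"
  shows "cat_functor C E (comp_ftor G F)"
proof -
  interpret F: cat_functor C D F by fact
  interpret G: cat_functor D E G by fact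
  show ?thesis
    by unfold_locales
      (simp_all add: comp_ftor_def F.FOb_Ob G.FOb_Ob F.FAr_Id G.FAr_Id
        F.FAr_Hom G.FAr_Hom F.FAr_Comp G.FAr_Comp[OF F.FAr_Hom F.FAr_Hom])
qed

lemma faithful_functor_comp_ftor:
  assumes "faithful_functor C D F" and "faithful_functor D E G"
  shows "faithful_functor C E (comp_ftor G F)"
proof -
  interpret F: faithful_functor C D F by fact
  interpret G: faithful_functor D E G by fact
  interpret GF: cat_functor C E "comp_ftor G F"
    by (rule cat_functor_comp_ftor) unfold_locales
  show ?thesis
  proof
    fix f g A B
    assume "f \<in> Hom C A B" "g \<in> Hom C A B" "FAr (comp_ftor G F) f = FAr (comp_ftor G F) g"
    then show "f = g"
      by (auto simp: comp_ftor_def intro: F.faithful G.faithful F.FAr_Hom)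
  qed
qed

lemma cat_functor_id_ftor:
  assumes "category C"
  shows "cat_functor C C id_ftor"
proof -
  interpret category C by fact
  show ?thesis by unfold_locales (auto simp: id_ftor_def)
qed

lemma Ob_full_subcat [simp]: "Ob (full_subcat C S) = Ob C \<inter> S"
  and Id_full_subcat [simp]: "Id (full_subcat C S) = Id C"
  and Comp_full_subcat [simp]: "Comp (full_subcat C S) = Comp C"
  by (simp_all add: full_subcat_def)

lemma Hom_full_subcat:
  "f \<in> Hom (full_subcat C S) A B \<longleftrightarrow> f \<in> Hom C A B \<and> A \<in> S \<and> B \<in> S"
  by (auto simp: full_subcat_def Hom_def)

lemma category_full_subcat:
  assumes "category C"
  shows "category (full_subcat C S)"
proof -
  interpret category C by fact
  show ?thesis
  proof
    show "Dom (full_subcat C S) f \<in> Ob (full_subcat C S)"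
      "Cod (full_subcat C S) f \<in> Ob (full_subcat C S)"
      if "f \<in> Ar (full_subcat C S)" for f
      using that by (auto simp: full_subcat_def Dom_Ob Cod_Ob)
  qed (auto simp: Hom_full_subcat Id_Hom Comp_Hom Comp_Id_left Comp_Id_right intro: Comp_assoc)
qed

lemma cat_functor_full_subcat:
  assumes "cat_functor C D F"
  shows "cat_functor (full_subcat C S) D F"
proof -
  interpret cat_functor C D F by fact
  interpret sub: category "full_subcat C S" by (rule category_full_subcat) unfold_locales
  show ?thesis
    by unfold_locales (auto simp: Hom_full_subcat FOb_Ob FAr_Hom FAr_Id FAr_Comp)
qed

lemma Hom_Set_cat: "m \<in> Hom Set_cat A B \<longleftrightarrow> (\<exists>f. m = Mor A f B \<and> f \<in> A \<rightarrow>\<^sub>E B)"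
  by (auto simp: Set_cat_def Hom_concrete_cat PiE_def)

lemma cat_functor_hom_ftor:
  assumes "category C"
  shows "cat_functor (op_cat C) Set_cat (hom_ftor C B)"
proof -
  interpret category C by fact
  interpret op: category "op_cat C" by (rule category_op_cat) fact
  interpret Set: category "Set_cat :: ('b set, ('b set, 'b) mor) cat" by (rule category_Set_cat)
  show ?thesis
  proof
    show "FOb (hom_ftor C B) A \<in> Ob Set_cat" for A
      by (simp add: Set_cat_def concrete_cat_def)
  next
    fix f A D assume "f \<in> Hom (op_cat C) A D"
    then have f: "f \<in> Hom C D A" by simp
    then have "Dom C f = D" "Cod C f = A" by (simp_all add: Hom_def)
    then show "FAr (hom_ftor C B) f \<in> Hom Set_cat (FOb (hom_ftor C B) A) (FOb (hom_ftor C B) D)"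
      using Comp_Hom[OF f] by (auto simp: hom_ftor_def Hom_Set_cat)
  next
    fix A assume "A \<in> Ob (op_cat C)"
    then have "Id C A \<in> Hom C A A" by (simp add: Id_Hom)
    then have "Dom C (Id C A) = A" "Cod C (Id C A) = A" by (simp_all add: Hom_def)
    then show "FAr (hom_ftor C B) (Id (op_cat C) A) = Id Set_cat (FOb (hom_ftor C B) A)"
      by (simp add: hom_ftor_def Set_cat_def Id_concrete_cat Comp_Id_right cong: restrict_cong)
  next
    fix f g A D E assume "f \<in> Hom (op_cat C) A D" "g \<in> Hom (op_cat C) D E"
    then have f: "f \<in> Hom C D A" and g: "g \<in> Hom C E D" by simp_all
    have fg: "Comp C f g \<in> Hom C E A" using Comp_Hom[OF g f] .
    have "Dom C f = D" "Cod C f = A" "Dom C g = E" "Cod C g = D"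
      "Dom C (Comp C f g) = E" "Cod C (Comp C f g) = A"
      using f g fg by (simp_all add: Hom_def)
    then show "FAr (hom_ftor C B) (Comp (op_cat C) g f) =
        Comp Set_cat (FAr (hom_ftor C B) g) (FAr (hom_ftor C B) f)"
      using Comp_Hom[OF f] Comp_assoc[OF g f]
      by (auto simp: hom_ftor_def Set_cat_def Comp_concrete_cat compose_def fun_eq_iff)
  qed
qed


section \<open>Faithful functors to sets\<close>

lemma faithful_functor_underlying:
  assumes cat: "category (concrete_cat S car M)"
    and funM: "\<And>A B f. A \<in> S \<Longrightarrow> B \<in> S \<Longrightarrow> f \<in> M A B \<Longrightarrow> f \<in> car A \<rightarrow> car B"
  shows "faithful_functor (concrete_cat S car M) Set_cat (underlying car)"
proof -
  interpret category "concrete_cat S car M" by fact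
  interpret Set: category "Set_cat :: ('b set, ('b set, 'b) mor) cat" by (rule category_Set_cat)
  show ?thesis
  proof
    show "FOb (underlying car) A \<in> Ob Set_cat" for A
      by (simp add: Set_cat_def concrete_cat_def)
    show "FAr (underlying car) f \<in> Hom Set_cat (FOb (underlying car) A) (FOb (underlying car) B)"
      if "f \<in> Hom (concrete_cat S car M) A B" for f A B
      using that funM by (fastforce simp: Hom_concrete_cat Hom_Set_cat underlying_def PiE_def)
    show "FAr (underlying car) (Id (concrete_cat S car M) A) =
        Id Set_cat (FOb (underlying car) A)" for A
      by (simp add: Id_concrete_cat Set_cat_def underlying_def)
    show "FAr (underlying car) (Comp (concrete_cat S car M) g f) =
        Comp Set_cat (FAr (underlying car) g) (FAr (underlying car) f)"
      if "f \<in> Hom (concrete_cat S car M) A B" "g \<in> Hom (concrete_cat S car M) B E" for f g A B E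
      using that by (auto simp: Hom_concrete_cat Comp_concrete_cat Set_cat_def underlying_def)
    show "f = g" if "f \<in> Hom (concrete_cat S car M) A B" "g \<in> Hom (concrete_cat S car M) A B"
      "FAr (underlying car) f = FAr (underlying car) g" for f g A B
      using that by (auto simp: Hom_concrete_cat underlying_def)
  qed
qed

text \<open>A category of structured sets, given abstractly by its faithful functor \<open>U\<close> to sets. An
  arrow \<open>f\<close> acts on the elements of \<open>FOb U (Dom A f)\<close> by \<open>fn (FAr U f)\<close>.\<close>

locale set_functor = faithful_functor A Set_cat U
  for A :: "('o, 'm) cat" and U :: "('o, 'm, 'x set, ('x set, 'x) mor) ftor"
begin

lemma action_closed: "f \<in> Hom A C D \<Longrightarrow> x \<in> FOb U C \<Longrightarrow> fn (FAr U f) x \<in> FOb U D"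
  using FAr_Hom[of f C D] by (auto simp: Hom_Set_cat)

lemma action_Id: "C \<in> Ob A \<Longrightarrow> x \<in> FOb U C \<Longrightarrow> fn (FAr U (Id A C)) x = x"
  by (simp add: FAr_Id Set_cat_def Id_concrete_cat)

lemma action_Comp:
  assumes "f \<in> Hom A C D" "g \<in> Hom A D E" "x \<in> FOb U C"
  shows "fn (FAr U (Comp A g f)) x = fn (FAr U g) (fn (FAr U f) x)"
  using FAr_Hom[OF assms(1)] FAr_Hom[OF assms(2)] assms(3)
  by (auto simp: FAr_Comp[OF assms(1,2)] Hom_Set_cat)
    (simp add: Set_cat_def Comp_concrete_cat compose_eq)

lemma arrow_eqI:
  assumes "f \<in> Hom A C D" "g \<in> Hom A C D"
    and "\<And>x. x \<in> FOb U C \<Longrightarrow> fn (FAr U f) x = fn (FAr U g) x"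
  shows "f = g"
proof (rule faithful[OF assms(1,2)])
  obtain f' g' where "FAr U f = Mor (FOb U C) f' (FOb U D)" "f' \<in> FOb U C \<rightarrow>\<^sub>E FOb U D"
    "FAr U g = Mor (FOb U C) g' (FOb U D)" "g' \<in> FOb U C \<rightarrow>\<^sub>E FOb U D"
    using FAr_Hom[OF assms(1)] FAr_Hom[OF assms(2)] by (auto simp: Hom_Set_cat)
  with assms(3) show "FAr U f = FAr U g" by (auto intro: PiE_ext)
qed

lemma is_lift_the_lift:
  assumes "lifts A U D E h"
  shows "is_lift A U D E h (the_lift A U D E h)"
proof -
  from assms obtain p where p: "is_lift A U D E h p" by (auto simp: lifts_def)
  then have "q = p" if "is_lift A U D E h q" for q
    using that by (auto simp: is_lift_def intro: arrow_eqI)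
  with p show ?thesis unfolding the_lift_def by (rule theI)
qed

lemma lifts_action: "p \<in> Hom A D E \<Longrightarrow> (\<And>x. x \<in> FOb U D \<Longrightarrow> fn (FAr U p) x = h x) \<Longrightarrow> lifts A U D E h"
  by (auto simp: lifts_def is_lift_def)

end

lemma lifts_cong:
  "(\<And>x. x \<in> FOb U D \<Longrightarrow> h x = h' x) \<Longrightarrow> lifts A U D E h \<longleftrightarrow> lifts A U D E h'"
  by (auto simp: lifts_def is_lift_def)


section \<open>The objects of the dual adjunction\<close>

lemma Hom_Top_cat:
  "m \<in> Hom Top_cat X Y \<longleftrightarrow>
     (\<exists>f. m = Mor X f Y \<and> f \<in> extensional (topspace X) \<and> continuous_map X Y f)"
  by (auto simp: Top_cat_def Hom_concrete_cat)

lemma Comp_Top_cat: "Comp Top_cat (Mor Y g Z) (Mor X f Y) = Mor X (compose (topspace X) g f) Z"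
  by (simp add: Top_cat_def Comp_concrete_cat)

lemma topspace_Sierpinski [simp]: "topspace Sierpinski = {0, 1}"
  by (auto simp: topspace_def openin_Sierpinski)

text \<open>The only nontrivial open set of the Sierpinski space is \<open>{1}\<close>.\<close>

lemma continuous_map_Sierpinski:
  "continuous_map X Sierpinski f \<longleftrightarrow>
     f \<in> topspace X \<rightarrow> {0, 1} \<and> openin X {x \<in> topspace X. f x = 1}"
proof -
  have "{x \<in> topspace X. f x \<in> {0, 1}} = topspace X" if "f \<in> topspace X \<rightarrow> {0, 1}"
    using that by auto
  then show ?thesis
    by (auto simp: continuous_map_def openin_Sierpinski)
qed

text \<open>An SFC-category together with a choice of cartesian lifts \<open>\<Lambda> X = (\<Omega> X, \<theta>\<^sub>X)\<close>.
  Facts about the category \<open>Cat P\<close> carry the prefix \<open>dom\<close>, those about its carrier functor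
  \<open>Ocar P\<close> the prefix \<open>Set\<close>, and those about \<open>Top_C P\<close> the prefix \<open>Top\<close>.\<close>

locale SFC_choice = SFC P
  for P :: "('o, 'm :: zero_neq_one, 'a) pfc" +
  fixes \<Lambda> :: "'m topology \<Rightarrow> 'o \<times> ('a \<Rightarrow> ('m topology, 'm) mor)"
  assumes choice: "lift_choice P \<Lambda>"
begin

text \<open>\<open>act f a\<close> is the value at \<open>a\<close> of the frame homomorphism underlying \<open>f\<close>.\<close>

abbreviation act :: "'m \<Rightarrow> 'a \<Rightarrow> 'a" where
  "act f \<equiv> fn (FAr (Ocar P) f)"

abbreviation U :: "'o \<Rightarrow> 'a set" where
  "U C \<equiv> FOb (Ocar P) C"

abbreviation arr :: "'o \<Rightarrow> 'o \<Rightarrow> 'm set" where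
  "arr C D \<equiv> Hom (Cat P) C D"

abbreviation "\<Omega> \<equiv> Omega_ob \<Lambda>"
abbreviation "\<theta> \<equiv> theta \<Lambda>"

sublocale Set: set_functor "Cat P" "Ocar P"
proof -
  have "faithful_functor (Frm :: ('a gorder, ('a gorder, 'a) mor) cat) Set_cat (underlying carrier)"
    unfolding Frm_def
    by (rule faithful_functor_underlying[OF category_Frm[unfolded Frm_def]])
      (simp add: frame_hom_def)
  then have "faithful_functor (Cat P) Set_cat (Ocar P)"
    unfolding Ocar_def by (rule faithful_functor_comp_ftor[OF faithful_functor_axioms])
  then show "set_functor (Cat P) (Ocar P)"
    by (simp add: set_functor_def)
qed

sublocale Top: category "Top_C P"
  unfolding Top_C_def by (rule category_full_subcat) (rule category_Top_cat)

lemma cat_functor_underlying_topspace: "cat_functor (Top_C P) Set_cat (underlying topspace)"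
proof -
  have "faithful_functor (Top_cat :: ('m topology, ('m topology, 'm) mor) cat)
      Set_cat (underlying topspace)"
    unfolding Top_cat_def
    by (rule faithful_functor_underlying[OF category_Top_cat[unfolded Top_cat_def]])
      (simp add: continuous_map_def)
  then show ?thesis
    unfolding Top_C_def by (intro cat_functor_full_subcat faithful_functor.axioms)
qed

lemma Hom_Top_C:
  "m \<in> Hom (Top_C P) X Y \<longleftrightarrow> m \<in> Hom Top_cat X Y \<and> X \<in> Ob (Top_C P) \<and> Y \<in> Ob (Top_C P)"
  by (auto simp: Top_C_def Hom_full_subcat Top_cat_def concrete_cat_def)

lemma Comp_Top_C [simp]: "Comp (Top_C P) = Comp Top_cat"
  by (simp add: Top_C_def)

lemma Id_Top_C: "Id (Top_C P) X = Mor X (\<lambda>x\<in>topspace X. x) X"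
  by (simp add: Top_C_def Top_cat_def Id_concrete_cat)

lemma Iota_bij: "bij_betw (Iota P) (U (Two P)) {0, 1}"
proof -
  obtain g where "frame_hom (FOb (Oftor P) (Two P)) two (Iota P)"
    "frame_hom two (FOb (Oftor P) (Two P)) g"
    "\<forall>x\<in>carrier (FOb (Oftor P) (Two P)). g (Iota P x) = x" "\<forall>y\<in>carrier two. Iota P (g y) = y"
    using Iota_iso by (auto simp: frame_iso_def)
  then show ?thesis
    by (intro bij_betw_byWitness[where f' = g])
      (auto simp: frame_hom_def Ocar_def comp_ftor_def underlying_def two_def)
qed

lemma Iota_in: "a \<in> U (Two P) \<Longrightarrow> Iota P a \<in> {0, 1}"
  using Iota_bij by (auto simp: bij_betw_def)

lemma Iota_chi: "fn g x \<in> {0, 1} \<Longrightarrow> Iota P (chi P x g) = fn g x"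
  unfolding chi_def by (rule bij_betw_inv_into_right[OF Iota_bij])

lemma chi_eq: "a \<in> U (Two P) \<Longrightarrow> fn g x = Iota P a \<Longrightarrow> chi P x g = a"
  unfolding chi_def by (simp add: bij_betw_inv_into_left[OF Iota_bij])

lemma chi_cong: "fn g x = fn g' x' \<Longrightarrow> chi P x g = chi P x' g'"
  by (simp add: chi_def)

lemma Omega_lift: "X \<in> Ob (Top_C P) \<Longrightarrow> Omega_lift P X (\<Omega> X, \<theta> X)"
  using choice by (simp add: lift_choice_def Omega_ob_def theta_def)

lemma Omega_Ob: "X \<in> Ob (Top_C P) \<Longrightarrow> \<Omega> X \<in> Ob (Cat P)"
  and theta_bij: "X \<in> Ob (Top_C P) \<Longrightarrow> bij_betw (\<theta> X) (U (\<Omega> X)) (Hom Top_cat X Sierpinski)"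
  using Omega_lift[of X] by (simp_all add: Omega_lift_def cartesian_lift_def)

lemma lifts_to_Omega_iff:
  assumes "X \<in> Ob (Top_C P)" "D \<in> Ob (Cat P)" "h \<in> U D \<rightarrow> U (\<Omega> X)"
  shows "lifts (Cat P) (Ocar P) D (\<Omega> X) h \<longleftrightarrow>
    (\<forall>x\<in>topspace X. lifts (Cat P) (Ocar P) D (Two P) (\<lambda>b. chi P x (\<theta> X (h b))))"
  using Omega_lift[OF assms(1)] assms(2,3) by (simp add: Omega_lift_def cartesian_lift_def)

lemma theta_in: "X \<in> Ob (Top_C P) \<Longrightarrow> b \<in> U (\<Omega> X) \<Longrightarrow> \<theta> X b \<in> Hom Top_cat X Sierpinski"
  using theta_bij[of X] by (auto simp: bij_betw_def)

lemma theta_inv_in: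
  "X \<in> Ob (Top_C P) \<Longrightarrow> g \<in> Hom Top_cat X Sierpinski \<Longrightarrow> theta_inv P \<Lambda> X g \<in> U (\<Omega> X)"
  and theta_theta_inv:
  "X \<in> Ob (Top_C P) \<Longrightarrow> g \<in> Hom Top_cat X Sierpinski \<Longrightarrow> \<theta> X (theta_inv P \<Lambda> X g) = g"
  and theta_inv_theta: "X \<in> Ob (Top_C P) \<Longrightarrow> b \<in> U (\<Omega> X) \<Longrightarrow> theta_inv P \<Lambda> X (\<theta> X b) = b"
  using theta_bij[of X]
  by (auto simp: theta_inv_def bij_betw_inv_into_right bij_betw_inv_into_left bij_betw_def inv_into_into)

lemma theta_inj:
  "X \<in> Ob (Top_C P) \<Longrightarrow> a \<in> U (\<Omega> X) \<Longrightarrow> b \<in> U (\<Omega> X) \<Longrightarrow> \<theta> X a = \<theta> X b \<Longrightarrow> a = b"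
  by (metis theta_inv_theta)

lemma fn_theta_in:
  "X \<in> Ob (Top_C P) \<Longrightarrow> b \<in> U (\<Omega> X) \<Longrightarrow> x \<in> topspace X \<Longrightarrow> fn (\<theta> X b) x \<in> {0, 1}"
  using theta_in[of X b] by (auto simp: Hom_Top_cat continuous_map_Sierpinski)

text \<open>The identity function on \<open>U (\<Omega> X)\<close> lifts, so by cartesianness every \<open>\<chi>\<^sub>x \<circ> \<theta>\<^sub>X\<close> lifts.\<close>

lemma is_lift_chi_bar:
  assumes X: "X \<in> Ob (Top_C P)" and x: "x \<in> topspace X"
  shows "is_lift (Cat P) (Ocar P) (\<Omega> X) (Two P) (\<lambda>b. chi P x (\<theta> X b)) (chi_bar P \<Lambda> X x)"
proof -
  note O = Omega_Ob[OF X]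
  have "lifts (Cat P) (Ocar P) (\<Omega> X) (\<Omega> X) (\<lambda>b. b)"
    using dom.Id_Hom[OF O] by (rule Set.lifts_action) (simp add: Set.action_Id O)
  then have "lifts (Cat P) (Ocar P) (\<Omega> X) (Two P) (\<lambda>b. chi P x (\<theta> X b))"
    using x by (subst (asm) lifts_to_Omega_iff[OF X O]) auto
  then show ?thesis unfolding chi_bar_def by (rule Set.is_lift_the_lift)
qed

lemma chi_bar_Hom:
  "X \<in> Ob (Top_C P) \<Longrightarrow> x \<in> topspace X \<Longrightarrow> chi_bar P \<Lambda> X x \<in> arr (\<Omega> X) (Two P)"
  and act_chi_bar:
  "X \<in> Ob (Top_C P) \<Longrightarrow> x \<in> topspace X \<Longrightarrow> b \<in> U (\<Omega> X) \<Longrightarrow>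
     act (chi_bar P \<Lambda> X x) b = chi P x (\<theta> X b)"
  using is_lift_chi_bar[of X x] by (simp_all add: is_lift_def)

lemma Iota_act_chi_bar:
  "X \<in> Ob (Top_C P) \<Longrightarrow> x \<in> topspace X \<Longrightarrow> b \<in> U (\<Omega> X) \<Longrightarrow>
     Iota P (act (chi_bar P \<Lambda> X x) b) = fn (\<theta> X b) x"
  by (simp add: act_chi_bar Iota_chi[OF fn_theta_in])

lemma Iota_act_in: "f \<in> arr C (Two P) \<Longrightarrow> a \<in> U C \<Longrightarrow> Iota P (act f a) \<in> {0, 1}"
  by (intro Iota_in Set.action_closed)

lemma ev_map_Hom:
  assumes C: "C \<in> Ob (Cat P)" and a: "a \<in> U C"
  shows "ev_map P C a \<in> Hom Top_cat (pt_space P C) Sierpinski"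
proof -
  have "{f \<in> arr C (Two P). (\<lambda>f\<in>arr C (Two P). Iota P (act f a)) f = 1} =
      {f \<in> arr C (Two P). Iota P (act f a) = 1}"
    by auto
  then have "openin (pt_space P C) {f \<in> arr C (Two P). (\<lambda>f\<in>arr C (Two P). Iota P (act f a)) f = 1}"
    using a openin_pt_space[OF C] by auto
  then show ?thesis
    using Iota_act_in[OF _ a]
    by (auto simp: ev_map_def Hom_Top_cat topspace_pt_space[OF C] continuous_map_Sierpinski)
qed

lemma fn_ev_map: "f \<in> arr C (Two P) \<Longrightarrow> fn (ev_map P C a) f = Iota P (act f a)"
  by (simp add: ev_map_def)


section \<open>The functors and the units\<close>

text \<open>The opens of \<open>pt_space P C\<close> are the sets where some \<open>ev_map P C a\<close> is \<open>1\<close>.\<close>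

lemma continuous_map_pt_space_iff:
  assumes C: "C \<in> Ob (Cat P)"
  shows "continuous_map X (pt_space P C) h \<longleftrightarrow> h \<in> topspace X \<rightarrow> arr C (Two P) \<and>
    (\<forall>a\<in>U C. openin X {x \<in> topspace X. Iota P (act (h x) a) = 1})"
proof -
  have eq: "{x \<in> topspace X. h x \<in> {f \<in> arr C (Two P). Iota P (act f a) = 1}} =
      {x \<in> topspace X. Iota P (act (h x) a) = 1}" if "h \<in> topspace X \<rightarrow> arr C (Two P)" for a
    using that by auto
  have "continuous_map X (pt_space P C) h \<longleftrightarrow> h \<in> topspace X \<rightarrow> arr C (Two P) \<and>
      (\<forall>a\<in>U C. openin X {x \<in> topspace X. h x \<in> {f \<in> arr C (Two P). Iota P (act f a) = 1}})"
    unfolding continuous_map_def topspace_pt_space[OF C] openin_pt_space[OF C] by blast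
  also have "\<dots> \<longleftrightarrow> h \<in> topspace X \<rightarrow> arr C (Two P) \<and>
      (\<forall>a\<in>U C. openin X {x \<in> topspace X. Iota P (act (h x) a) = 1})"
    by (intro conj_cong refl ball_cong) (simp only: eq)
  finally show ?thesis .
qed

lemma pt_ftor_arrow:
  assumes "f \<in> arr C D"
  shows "FAr (pt_ftor P) f =
    Mor (pt_space P D) (\<lambda>g\<in>arr D (Two P). Comp (Cat P) g f) (pt_space P C)"
  using assms by (auto simp: pt_ftor_def Hom_def)

lemma Hom_Obs: "f \<in> arr C D \<Longrightarrow> C \<in> Ob (Cat P) \<and> D \<in> Ob (Cat P)"
  by (auto simp: Hom_def dom.Dom_Ob dom.Cod_Ob)

lemma FOb_pt_ftor [simp]: "FOb (pt_ftor P) = pt_space P"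
  by (simp add: pt_ftor_def)

lemma FOb_Omega_ftor [simp]: "FOb (Omega_ftor P \<Lambda>) = \<Omega>"
  by (simp add: Omega_ftor_def)

lemma pt_ftor_Hom:
  assumes f: "f \<in> arr C D"
  shows "FAr (pt_ftor P) f \<in> Hom (Top_C P) (pt_space P D) (pt_space P C)"
proof -
  have C: "C \<in> Ob (Cat P)" and D: "D \<in> Ob (Cat P)" using Hom_Obs[OF f] by auto
  have eq: "Iota P (act ((\<lambda>g\<in>arr D (Two P). Comp (Cat P) g f) g) a) = Iota P (act g (act f a))"
    if "g \<in> arr D (Two P)" "a \<in> U C" for g a
    using that by (simp add: Set.action_Comp[OF f])
  have "openin (pt_space P D)
      {g \<in> arr D (Two P). Iota P (act ((\<lambda>g\<in>arr D (Two P). Comp (Cat P) g f) g) a) = 1}"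
    if a: "a \<in> U C" for a
    using Set.action_closed[OF f a] eq[OF _ a] unfolding openin_pt_space[OF D]
    by (intro bexI[of _ "act f a"]) auto
  then have "continuous_map (pt_space P D) (pt_space P C) (\<lambda>g\<in>arr D (Two P). Comp (Cat P) g f)"
    using dom.Comp_Hom[OF f]
    by (simp add: continuous_map_pt_space_iff[OF C] topspace_pt_space[OF D])
  then show ?thesis
    by (simp add: pt_ftor_arrow[OF f] Hom_Top_C Hom_Top_cat topspace_pt_space[OF D]
      pt_space_Top_C C D)
qed

lemma cat_functor_pt: "cat_functor (Cat P) (op_cat (Top_C P)) (pt_ftor P)"
proof -
  interpret op: category "op_cat (Top_C P)" by (rule category_op_cat) unfold_locales
  show ?thesis
  proof
    show "FOb (pt_ftor P) A \<in> Ob (op_cat (Top_C P))" if "A \<in> Ob (Cat P)" for A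
      using that by (simp add: pt_space_Top_C)
    show "FAr (pt_ftor P) f \<in> Hom (op_cat (Top_C P)) (FOb (pt_ftor P) A) (FOb (pt_ftor P) B)"
      if "f \<in> arr A B" for f A B
      using pt_ftor_Hom[OF that] by simp
    show "FAr (pt_ftor P) (Id (Cat P) A) = Id (op_cat (Top_C P)) (FOb (pt_ftor P) A)"
      if "A \<in> Ob (Cat P)" for A
      using that
      by (simp add: pt_ftor_arrow[OF dom.Id_Hom] Id_Top_C topspace_pt_space
        dom.Comp_Id_right cong: restrict_cong)
    show "FAr (pt_ftor P) (Comp (Cat P) g f) =
        Comp (op_cat (Top_C P)) (FAr (pt_ftor P) g) (FAr (pt_ftor P) f)"
      if f: "f \<in> arr A B" and g: "g \<in> arr B E" for f g A B E
    proof -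
      have E: "E \<in> Ob (Cat P)" using Hom_Obs[OF g] by simp
      show ?thesis
        using dom.Comp_Hom[OF g] dom.Comp_assoc[OF f g]
        by (auto simp: pt_ftor_arrow[OF f] pt_ftor_arrow[OF g] pt_ftor_arrow[OF dom.Comp_Hom[OF f g]]
          Comp_Top_cat compose_def topspace_pt_space[OF E] fun_eq_iff)
    qed
  qed
qed

lemma Comp_theta_Hom:
  assumes f: "f \<in> Hom (Top_C P) X Y" and b: "b \<in> U (\<Omega> Y)"
  shows "Comp Top_cat (\<theta> Y b) f \<in> Hom Top_cat X Sierpinski"
  using category.Comp_Hom[OF category_Top_cat] theta_in[OF _ b] f by (auto simp: Hom_Top_C)

lemma fn_Comp_Top:
  "f \<in> Hom Top_cat X Y \<Longrightarrow> x \<in> topspace X \<Longrightarrow> fn (Comp Top_cat g f) x = fn g (fn f x)"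
  by (auto simp: Hom_Top_cat) (simp add: Top_cat_def concrete_cat_def compose_eq)

lemma fn_Top_in: "f \<in> Hom Top_cat X Y \<Longrightarrow> x \<in> topspace X \<Longrightarrow> fn f x \<in> topspace Y"
  by (auto simp: Hom_Top_cat continuous_map_def)

lemma Top_arrow_eqI:
  assumes "f \<in> Hom Top_cat X Y" "g \<in> Hom Top_cat X Y"
    and "\<And>x. x \<in> topspace X \<Longrightarrow> fn f x = fn g x"
  shows "f = g"
  using assms by (auto simp: Hom_Top_cat intro: extensionalityI)

text \<open>Since \<open>\<chi>\<^sub>x (g \<circ> f) = \<chi>\<^bsub>f x\<^esub> g\<close>, the tests for lifting \<open>Omega_fun P \<Lambda> f\<close> to
  \<open>\<Omega> X\<close> are among the arrows \<open>chi_bar\<close> of \<open>Y\<close>.\<close>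

lemma is_lift_Omega:
  assumes f: "f \<in> Hom (Top_C P) X Y"
  shows "is_lift (Cat P) (Ocar P) (\<Omega> Y) (\<Omega> X) (Omega_fun P \<Lambda> f) (FAr (Omega_ftor P \<Lambda>) f)"
proof -
  have X: "X \<in> Ob (Top_C P)" and Y: "Y \<in> Ob (Top_C P)" and f': "f \<in> Hom Top_cat X Y"
    using f by (auto simp: Hom_Top_C)
  have st: "src f = X" "tgt f = Y" using f' by (auto simp: Hom_Top_cat)
  have "Omega_fun P \<Lambda> f \<in> U (\<Omega> Y) \<rightarrow> U (\<Omega> X)"
    using theta_inv_in[OF X Comp_theta_Hom[OF f]] by (simp add: Omega_fun_def st Pi_iff)
  moreover have "lifts (Cat P) (Ocar P) (\<Omega> Y) (Two P) (\<lambda>b. chi P x (\<theta> X (Omega_fun P \<Lambda> f b)))"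
    if x: "x \<in> topspace X" for x
  proof (rule Set.lifts_action)
    have y: "fn f x \<in> topspace Y" using fn_Top_in[OF f' x] .
    show "chi_bar P \<Lambda> Y (fn f x) \<in> arr (\<Omega> Y) (Two P)" using chi_bar_Hom[OF Y y] .
    show "act (chi_bar P \<Lambda> Y (fn f x)) b = chi P x (\<theta> X (Omega_fun P \<Lambda> f b))"
      if b: "b \<in> U (\<Omega> Y)" for b
      unfolding act_chi_bar[OF Y y b]
      by (rule chi_cong)
        (simp add: Omega_fun_def st theta_theta_inv[OF X Comp_theta_Hom[OF f b]] fn_Comp_Top[OF f' x])
  qed
  ultimately have "lifts (Cat P) (Ocar P) (\<Omega> Y) (\<Omega> X) (Omega_fun P \<Lambda> f)"
    by (subst lifts_to_Omega_iff[OF X Omega_Ob[OF Y]]) auto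
  then show ?thesis
    unfolding Omega_ftor_def by (simp add: st Set.is_lift_the_lift)
qed

lemma Omega_Hom: "f \<in> Hom (Top_C P) X Y \<Longrightarrow> FAr (Omega_ftor P \<Lambda>) f \<in> arr (\<Omega> Y) (\<Omega> X)"
  using is_lift_Omega by (simp add: is_lift_def)

lemma theta_act_Omega:
  assumes f: "f \<in> Hom (Top_C P) X Y" and b: "b \<in> U (\<Omega> Y)"
  shows "\<theta> X (act (FAr (Omega_ftor P \<Lambda>) f) b) = Comp Top_cat (\<theta> Y b) f"
proof -
  have "X \<in> Ob (Top_C P)" "src f = X" "tgt f = Y"
    using f by (auto simp: Hom_Top_C Hom_Top_cat)
  then show ?thesis
    using is_lift_Omega[OF f] b
    by (simp add: is_lift_def Omega_fun_def theta_theta_inv Comp_theta_Hom[OF f b])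
qed

text \<open>Arrows into \<open>\<Omega> X\<close> are equal if they become equal after \<open>\<theta>\<^sub>X\<close>.\<close>

lemma arrow_to_Omega_eqI:
  assumes X: "X \<in> Ob (Top_C P)" and f: "f \<in> arr C (\<Omega> X)" and g: "g \<in> arr C (\<Omega> X)"
    and eq: "\<And>a. a \<in> U C \<Longrightarrow> \<theta> X (act f a) = \<theta> X (act g a)"
  shows "f = g"
  using f g
proof (rule Set.arrow_eqI)
  fix a assume "a \<in> U C"
  then show "act f a = act g a"
    using eq Set.action_closed[OF f] Set.action_closed[OF g] by (blast intro: theta_inj[OF X])
qed

lemma cat_functor_Omega: "cat_functor (op_cat (Top_C P)) (Cat P) (Omega_ftor P \<Lambda>)"
proof -
  interpret op: category "op_cat (Top_C P)" by (rule category_op_cat) unfold_locales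
  show ?thesis
  proof
    show "FOb (Omega_ftor P \<Lambda>) X \<in> Ob (Cat P)" if "X \<in> Ob (op_cat (Top_C P))" for X
      using that by (simp add: Omega_Ob)
    show "FAr (Omega_ftor P \<Lambda>) f \<in> arr (FOb (Omega_ftor P \<Lambda>) X) (FOb (Omega_ftor P \<Lambda>) Y)"
      if "f \<in> Hom (op_cat (Top_C P)) X Y" for f X Y
      using that by (simp add: Omega_Hom)
    show "FAr (Omega_ftor P \<Lambda>) (Id (op_cat (Top_C P)) X) = Id (Cat P) (FOb (Omega_ftor P \<Lambda>) X)"
      if "X \<in> Ob (op_cat (Top_C P))" for X
    proof -
      have X: "X \<in> Ob (Top_C P)" using that by simp
      note id = Top.Id_Hom[OF X] and O = Omega_Ob[OF X]
      have "FAr (Omega_ftor P \<Lambda>) (Id (Top_C P) X) = Id (Cat P) (\<Omega> X)"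
      proof (rule arrow_to_Omega_eqI[OF X Omega_Hom[OF id] dom.Id_Hom[OF O]])
        fix b assume b: "b \<in> U (\<Omega> X)"
        show "\<theta> X (act (FAr (Omega_ftor P \<Lambda>) (Id (Top_C P) X)) b) = \<theta> X (act (Id (Cat P) (\<Omega> X)) b)"
          using category.Comp_Id_right[OF category_Top_cat theta_in[OF X b]]
          by (simp add: theta_act_Omega[OF id b] Set.action_Id[OF O b]) (simp add: Top_C_def)
      qed
      then show ?thesis by (simp)
    qed
    show "FAr (Omega_ftor P \<Lambda>) (Comp (op_cat (Top_C P)) g f) =
        Comp (Cat P) (FAr (Omega_ftor P \<Lambda>) g) (FAr (Omega_ftor P \<Lambda>) f)"
      if "f \<in> Hom (op_cat (Top_C P)) X Y" "g \<in> Hom (op_cat (Top_C P)) Y Z" for f g X Y Z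
    proof -
      have f: "f \<in> Hom (Top_C P) Y X" and g: "g \<in> Hom (Top_C P) Z Y" using that by simp_all
      have f': "f \<in> Hom Top_cat Y X" and g': "g \<in> Hom Top_cat Z Y"
        and X: "X \<in> Ob (Top_C P)" and Z: "Z \<in> Ob (Top_C P)"
        using f g by (auto simp: Hom_Top_C)
      note fg = Top.Comp_Hom[OF g f] and Of = Omega_Hom[OF f] and Og = Omega_Hom[OF g]
      have "FAr (Omega_ftor P \<Lambda>) (Comp (Top_C P) f g) =
          Comp (Cat P) (FAr (Omega_ftor P \<Lambda>) g) (FAr (Omega_ftor P \<Lambda>) f)"
      proof (rule arrow_to_Omega_eqI[OF Z Omega_Hom[OF fg] dom.Comp_Hom[OF Of Og]])
        fix b assume b: "b \<in> U (\<Omega> X)"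
        show "\<theta> Z (act (FAr (Omega_ftor P \<Lambda>) (Comp (Top_C P) f g)) b) =
            \<theta> Z (act (Comp (Cat P) (FAr (Omega_ftor P \<Lambda>) g) (FAr (Omega_ftor P \<Lambda>) f)) b)"
          using category.Comp_assoc[OF category_Top_cat g' f' theta_in[OF X b]]
          by (simp only: theta_act_Omega[OF fg[unfolded Comp_Top_C] b] Set.action_Comp[OF Of Og b]
            theta_act_Omega[OF g Set.action_closed[OF Of b]] theta_act_Omega[OF f b] Comp_Top_C)
      qed
      then show ?thesis by simp
    qed
  qed
qed

text \<open>For \<open>f\<close> in \<open>pt_space P C\<close> the test \<open>\<chi>\<^sub>f\<close> turns \<open>eta_fun P \<Lambda> C\<close> into the action of
  \<open>f\<close>, which lifts to \<open>f\<close> itself.\<close>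

lemma is_lift_eta:
  assumes C: "C \<in> Ob (Cat P)"
  shows "is_lift (Cat P) (Ocar P) C (\<Omega> (pt_space P C)) (eta_fun P \<Lambda> C) (eta P \<Lambda> C)"
proof -
  note X = pt_space_Top_C[OF C]
  have "eta_fun P \<Lambda> C \<in> U C \<rightarrow> U (\<Omega> (pt_space P C))"
    using theta_inv_in[OF X ev_map_Hom[OF C]] by (simp add: eta_fun_def Pi_iff)
  moreover have "lifts (Cat P) (Ocar P) C (Two P)
      (\<lambda>a. chi P f (\<theta> (pt_space P C) (eta_fun P \<Lambda> C a)))"
    if f: "f \<in> arr C (Two P)" for f
  proof (rule Set.lifts_action[OF f])
    show "act f a = chi P f (\<theta> (pt_space P C) (eta_fun P \<Lambda> C a))" if a: "a \<in> U C" for a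
      by (rule chi_eq[symmetric])
        (simp_all add: Set.action_closed[OF f a] eta_fun_def
          theta_theta_inv[OF X ev_map_Hom[OF C a]] fn_ev_map[OF f])
  qed
  ultimately have "lifts (Cat P) (Ocar P) C (\<Omega> (pt_space P C)) (eta_fun P \<Lambda> C)"
    by (subst lifts_to_Omega_iff[OF X C]) (auto simp: topspace_pt_space[OF C])
  then show ?thesis unfolding eta_def by (rule Set.is_lift_the_lift)
qed

lemma eta_Hom: "C \<in> Ob (Cat P) \<Longrightarrow> eta P \<Lambda> C \<in> arr C (\<Omega> (pt_space P C))"
  using is_lift_eta by (simp add: is_lift_def)

lemma theta_act_eta:
  "C \<in> Ob (Cat P) \<Longrightarrow> a \<in> U C \<Longrightarrow> \<theta> (pt_space P C) (act (eta P \<Lambda> C) a) = ev_map P C a"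
  using is_lift_eta[of C]
  by (simp add: is_lift_def eta_fun_def theta_theta_inv pt_space_Top_C ev_map_Hom)

text \<open>The inverse image under \<open>sigma P \<Lambda> X\<close> of the open set given by \<open>b\<close> is the open
  set classified by \<open>\<theta>\<^sub>X b\<close>.\<close>

lemma sigma_Hom:
  assumes X: "X \<in> Ob (Top_C P)"
  shows "sigma P \<Lambda> X \<in> Hom (Top_C P) X (pt_space P (\<Omega> X))"
proof -
  note O = Omega_Ob[OF X]
  have "openin X {x \<in> topspace X. Iota P (act ((\<lambda>x\<in>topspace X. chi_bar P \<Lambda> X x) x) b) = 1}"
    if b: "b \<in> U (\<Omega> X)" for b
  proof -
    have "{x \<in> topspace X. Iota P (act ((\<lambda>x\<in>topspace X. chi_bar P \<Lambda> X x) x) b) = 1} =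
        {x \<in> topspace X. fn (\<theta> X b) x = 1}"
      using Iota_act_chi_bar[OF X _ b] by auto
    then show ?thesis
      using theta_in[OF X b] by (auto simp: Hom_Top_cat continuous_map_Sierpinski)
  qed
  then have "continuous_map X (pt_space P (\<Omega> X)) (\<lambda>x\<in>topspace X. chi_bar P \<Lambda> X x)"
    using chi_bar_Hom[OF X] by (auto simp: continuous_map_pt_space_iff[OF O])
  then show ?thesis
    by (simp add: sigma_def Hom_Top_C Hom_Top_cat X pt_space_Top_C[OF O])
qed

lemma fn_sigma: "x \<in> topspace X \<Longrightarrow> fn (sigma P \<Lambda> X) x = chi_bar P \<Lambda> X x"
  by (simp add: sigma_def)


section \<open>The adjunction\<close>

lemma fn_pt_ftor:
  "f \<in> arr C D \<Longrightarrow> g \<in> arr D (Two P) \<Longrightarrow> fn (FAr (pt_ftor P) f) g = Comp (Cat P) g f"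
  by (simp add: pt_ftor_arrow)

lemma Top_C_arrow_eqI:
  assumes "f \<in> Hom (Top_C P) X Y" "g \<in> Hom (Top_C P) X Y"
    and "\<And>x. x \<in> topspace X \<Longrightarrow> fn f x = fn g x"
  shows "f = g"
  by (rule Top_arrow_eqI[of _ X Y]) (use assms in \<open>auto simp: Hom_Top_C\<close>)

lemma fn_Comp_Top_C:
  "f \<in> Hom (Top_C P) X Y \<Longrightarrow> x \<in> topspace X \<Longrightarrow> fn (Comp Top_cat g f) x = fn g (fn f x)"
  by (auto simp: Hom_Top_C intro: fn_Comp_Top)

text \<open>Pulling back \<open>ev_map P C a\<close> along precomposition with \<open>f\<close> gives evaluation at
  \<open>act f a\<close>.\<close>

lemma ev_map_pt_ftor:
  assumes f: "f \<in> arr C D" and a: "a \<in> U C"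
  shows "Comp Top_cat (ev_map P C a) (FAr (pt_ftor P) f) = ev_map P D (act f a)"
proof -
  have C: "C \<in> Ob (Cat P)" and D: "D \<in> Ob (Cat P)" using Hom_Obs[OF f] by auto
  have pf: "FAr (pt_ftor P) f \<in> Hom Top_cat (pt_space P D) (pt_space P C)"
    using pt_ftor_Hom[OF f] by (simp add: Hom_Top_C)
  show ?thesis
  proof (rule Top_arrow_eqI[OF category.Comp_Hom[OF category_Top_cat pf ev_map_Hom[OF C a]]
        ev_map_Hom[OF D Set.action_closed[OF f a]]])
    fix g assume g: "g \<in> topspace (pt_space P D)"
    then have g': "g \<in> arr D (Two P)" by (simp add: topspace_pt_space[OF D])
    show "fn (Comp Top_cat (ev_map P C a) (FAr (pt_ftor P) f)) g = fn (ev_map P D (act f a)) g"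
      by (simp add: fn_Comp_Top[OF pf g] fn_pt_ftor[OF f g'] fn_ev_map[OF dom.Comp_Hom[OF f g']]
        fn_ev_map[OF g'] Set.action_Comp[OF f g' a])
  qed
qed

lemma eta_natural:
  assumes f: "f \<in> arr C D"
  shows "Comp (Cat P) (FAr (Omega_ftor P \<Lambda>) (FAr (pt_ftor P) f)) (eta P \<Lambda> C) =
    Comp (Cat P) (eta P \<Lambda> D) f"
proof -
  have C: "C \<in> Ob (Cat P)" and D: "D \<in> Ob (Cat P)" using Hom_Obs[OF f] by auto
  note pf = pt_ftor_Hom[OF f] and Opf = Omega_Hom[OF pt_ftor_Hom[OF f]]
  show ?thesis
  proof (rule arrow_to_Omega_eqI[OF pt_space_Top_C[OF D]
        dom.Comp_Hom[OF eta_Hom[OF C] Opf] dom.Comp_Hom[OF f eta_Hom[OF D]]])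
    fix a assume a: "a \<in> U C"
    show "\<theta> (pt_space P D) (act (Comp (Cat P) (FAr (Omega_ftor P \<Lambda>) (FAr (pt_ftor P) f))
          (eta P \<Lambda> C)) a) =
        \<theta> (pt_space P D) (act (Comp (Cat P) (eta P \<Lambda> D) f) a)"
      by (simp add: Set.action_Comp[OF eta_Hom[OF C] Opf a] Set.action_Comp[OF f eta_Hom[OF D] a]
        theta_act_Omega[OF pf Set.action_closed[OF eta_Hom[OF C] a]]
        theta_act_eta[OF C a] theta_act_eta[OF D Set.action_closed[OF f a]] ev_map_pt_ftor[OF f a])
  qed
qed

text \<open>Naturality of \<open>sigma P \<Lambda>\<close> at a single point \<open>x\<close>.\<close>

lemma chi_bar_Omega:
  assumes f: "f \<in> Hom (Top_C P) X Y" and x: "x \<in> topspace X"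
  shows "Comp (Cat P) (chi_bar P \<Lambda> X x) (FAr (Omega_ftor P \<Lambda>) f) = chi_bar P \<Lambda> Y (fn f x)"
proof -
  have X: "X \<in> Ob (Top_C P)" and Y: "Y \<in> Ob (Top_C P)" and f': "f \<in> Hom Top_cat X Y"
    using f by (auto simp: Hom_Top_C)
  note y = fn_Top_in[OF f' x] and Of = Omega_Hom[OF f]
  show ?thesis
  proof (rule Set.arrow_eqI[OF dom.Comp_Hom[OF Of chi_bar_Hom[OF X x]] chi_bar_Hom[OF Y y]])
    fix b assume b: "b \<in> U (\<Omega> Y)"
    show "act (Comp (Cat P) (chi_bar P \<Lambda> X x) (FAr (Omega_ftor P \<Lambda>) f)) b =
        act (chi_bar P \<Lambda> Y (fn f x)) b"
      by (simp add: Set.action_Comp[OF Of chi_bar_Hom[OF X x] b] act_chi_bar[OF Y y b]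
        act_chi_bar[OF X x Set.action_closed[OF Of b]] theta_act_Omega[OF f b])
        (rule chi_cong, rule fn_Comp_Top[OF f' x])
  qed
qed

lemma sigma_natural:
  assumes f: "f \<in> Hom (Top_C P) X Y"
  shows "Comp Top_cat (sigma P \<Lambda> Y) f =
    Comp Top_cat (FAr (pt_ftor P) (FAr (Omega_ftor P \<Lambda>) f)) (sigma P \<Lambda> X)"
proof -
  have X: "X \<in> Ob (Top_C P)" and Y: "Y \<in> Ob (Top_C P)" and f': "f \<in> Hom Top_cat X Y"
    using f by (auto simp: Hom_Top_C)
  note Of = Omega_Hom[OF f]
  note pOf = pt_ftor_Hom[OF Of]
  show ?thesis
  proof (rule Top_C_arrow_eqI[OF Top.Comp_Hom[OF f sigma_Hom[OF Y], unfolded Comp_Top_C]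
        Top.Comp_Hom[OF sigma_Hom[OF X] pOf, unfolded Comp_Top_C]])
    fix x assume x: "x \<in> topspace X"
    show "fn (Comp Top_cat (sigma P \<Lambda> Y) f) x =
        fn (Comp Top_cat (FAr (pt_ftor P) (FAr (Omega_ftor P \<Lambda>) f)) (sigma P \<Lambda> X)) x"
      by (simp add: fn_Comp_Top_C[OF f x] fn_Comp_Top_C[OF sigma_Hom[OF X] x]
        fn_sigma[OF x] fn_sigma[OF fn_Top_in[OF f' x]] fn_pt_ftor[OF Of chi_bar_Hom[OF X x]]
        chi_bar_Omega[OF f x])
  qed
qed

text \<open>The triangle identity for \<open>pt_ftor P\<close> at a single point \<open>f\<close>.\<close>

lemma chi_bar_eta:
  assumes f: "f \<in> arr C (Two P)"
  shows "Comp (Cat P) (chi_bar P \<Lambda> (pt_space P C) f) (eta P \<Lambda> C) = f"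
proof -
  have C: "C \<in> Ob (Cat P)" using Hom_Obs[OF f] by simp
  note X = pt_space_Top_C[OF C] and e = eta_Hom[OF C]
  have f': "f \<in> topspace (pt_space P C)" using f by (simp add: topspace_pt_space[OF C])
  show ?thesis
  proof (rule Set.arrow_eqI[OF dom.Comp_Hom[OF e chi_bar_Hom[OF X f']] f])
    fix a assume a: "a \<in> U C"
    show "act (Comp (Cat P) (chi_bar P \<Lambda> (pt_space P C) f) (eta P \<Lambda> C)) a = act f a"
      by (simp add: Set.action_Comp[OF e chi_bar_Hom[OF X f'] a] theta_act_eta[OF C a]
        act_chi_bar[OF X f' Set.action_closed[OF e a]])
        (rule chi_eq[OF Set.action_closed[OF f a] fn_ev_map[OF f]])
  qed
qed

lemma triangle_pt:
  assumes C: "C \<in> Ob (Cat P)"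
  shows "Comp Top_cat (FAr (pt_ftor P) (eta P \<Lambda> C)) (sigma P \<Lambda> (pt_space P C)) =
    Id (Top_C P) (pt_space P C)"
proof -
  note X = pt_space_Top_C[OF C] and e = eta_Hom[OF C]
  note s = sigma_Hom[OF X] and pe = pt_ftor_Hom[OF e]
  show ?thesis
  proof (rule Top_C_arrow_eqI[OF Top.Comp_Hom[OF s pe, unfolded Comp_Top_C] Top.Id_Hom[OF X]])
    fix f assume f: "f \<in> topspace (pt_space P C)"
    then have f': "f \<in> arr C (Two P)" by (simp add: topspace_pt_space[OF C])
    show "fn (Comp Top_cat (FAr (pt_ftor P) (eta P \<Lambda> C)) (sigma P \<Lambda> (pt_space P C))) f =
        fn (Id (Top_C P) (pt_space P C)) f"
      by (simp add: fn_Comp_Top_C[OF s f] fn_sigma[OF f] fn_pt_ftor[OF e chi_bar_Hom[OF X f]]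
        chi_bar_eta[OF f'] Id_Top_C f)
  qed
qed

lemma triangle_Omega:
  assumes X: "X \<in> Ob (Top_C P)"
  shows "Comp (Cat P) (FAr (Omega_ftor P \<Lambda>) (sigma P \<Lambda> X)) (eta P \<Lambda> (\<Omega> X)) = Id (Cat P) (\<Omega> X)"
proof -
  note O = Omega_Ob[OF X] and s = sigma_Hom[OF X]
  note e = eta_Hom[OF O] and Os = Omega_Hom[OF s]
  have s': "sigma P \<Lambda> X \<in> Hom Top_cat X (pt_space P (\<Omega> X))" using s by (simp add: Hom_Top_C)
  show ?thesis
  proof (rule arrow_to_Omega_eqI[OF X dom.Comp_Hom[OF e Os] dom.Id_Hom[OF O]])
    fix b assume b: "b \<in> U (\<Omega> X)"
    \<comment> \<open>The action of \<open>chi_bar P \<Lambda> X x\<close> on \<open>b\<close> corresponds under \<open>\<iota>\<close> to the value of \<open>\<theta>\<^sub>X b\<close> at \<open>x\<close>.\<close>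
    have "Comp Top_cat (ev_map P (\<Omega> X) b) (sigma P \<Lambda> X) = \<theta> X b"
    proof (rule Top_arrow_eqI[OF category.Comp_Hom[OF category_Top_cat s' ev_map_Hom[OF O b]]
          theta_in[OF X b]])
      fix x assume x: "x \<in> topspace X"
      show "fn (Comp Top_cat (ev_map P (\<Omega> X) b) (sigma P \<Lambda> X)) x = fn (\<theta> X b) x"
        by (simp add: fn_Comp_Top[OF s' x] fn_sigma[OF x] fn_ev_map[OF chi_bar_Hom[OF X x]]
          Iota_act_chi_bar[OF X x b])
    qed
    then show "\<theta> X (act (Comp (Cat P) (FAr (Omega_ftor P \<Lambda>) (sigma P \<Lambda> X)) (eta P \<Lambda> (\<Omega> X))) b) =
        \<theta> X (act (Id (Cat P) (\<Omega> X)) b)"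
      by (simp add: Set.action_Comp[OF e Os b] theta_act_Omega[OF s Set.action_closed[OF e b]]
        theta_act_eta[OF O b] Set.action_Id[OF O b])
  qed
qed

lemma adjunction_pt_Omega:
  "adjunction (Cat P) (op_cat (Top_C P)) (pt_ftor P) (Omega_ftor P \<Lambda>) (eta P \<Lambda>) (sigma P \<Lambda>)"
proof -
  interpret pt: cat_functor "Cat P" "op_cat (Top_C P)" "pt_ftor P" by (rule cat_functor_pt)
  interpret Om: cat_functor "op_cat (Top_C P)" "Cat P" "Omega_ftor P \<Lambda>" by (rule cat_functor_Omega)
  interpret idC: cat_functor "Cat P" "Cat P" id_ftor
    by (rule cat_functor_id_ftor) unfold_locales
  interpret idT: cat_functor "op_cat (Top_C P)" "op_cat (Top_C P)" id_ftor
    by (rule cat_functor_id_ftor) unfold_locales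
  interpret Om_pt: cat_functor "Cat P" "Cat P" "comp_ftor (Omega_ftor P \<Lambda>) (pt_ftor P)"
    by (rule cat_functor_comp_ftor) unfold_locales
  interpret pt_Om: cat_functor "op_cat (Top_C P)" "op_cat (Top_C P)"
    "comp_ftor (pt_ftor P) (Omega_ftor P \<Lambda>)"
    by (rule cat_functor_comp_ftor) unfold_locales
  show ?thesis
    by unfold_locales
      (simp_all add: id_ftor_def comp_ftor_def eta_Hom sigma_Hom eta_natural sigma_natural
        triangle_pt triangle_Omega)
qed


section \<open>Representability and naturality\<close>

lemma represented_pt_Omega:
  "represented_by (Cat P) (Ocar P) (Top_C P) (underlying topspace)
     (pt_ftor P) (Omega_ftor P \<Lambda>) (Two P) Sierpinski (\<lambda>C f. f) \<theta>"
  unfolding represented_by_def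
proof (intro conjI)
  show "Two P \<in> Ob (Cat P)" by (rule Two_Ob)
  show "Sierpinski \<in> Ob (Top_C P)" by (rule Sierpinski_Top_C)
  show "set_nat_iso (op_cat (Cat P)) (comp_ftor (underlying topspace) (pt_ftor P))
      (hom_ftor (Cat P) (Two P)) (\<lambda>C f. f)"
    unfolding set_nat_iso_def
  proof (intro conjI ballI)
    \<comment> \<open>The opposite of \<open>pt_ftor P\<close> has values in \<open>op_cat (op_cat (Top_C P))\<close>, which is \<open>Top_C P\<close>.\<close>
    have "cat_functor (op_cat (Cat P)) (Top_C P) (pt_ftor P)"
      using cat_functor_op_cat[OF cat_functor_pt] by simp
    then show "cat_functor (op_cat (Cat P)) Set_cat (comp_ftor (underlying topspace) (pt_ftor P))"
      using cat_functor_underlying_topspace by (rule cat_functor_comp_ftor)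
    show "cat_functor (op_cat (Cat P)) Set_cat (hom_ftor (Cat P) (Two P))"
      by (rule cat_functor_hom_ftor) unfold_locales
  next
    fix C assume "C \<in> Ob (op_cat (Cat P))"
    then show "bij_betw (\<lambda>f. f) (FOb (comp_ftor (underlying topspace) (pt_ftor P)) C)
        (FOb (hom_ftor (Cat P) (Two P)) C)"
      by (simp add: comp_ftor_def underlying_def hom_ftor_def topspace_pt_space bij_betw_def)
  next
    fix C D f g
    assume "f \<in> Hom (op_cat (Cat P)) C D"
      and g: "g \<in> FOb (comp_ftor (underlying topspace) (pt_ftor P)) C"
    then have f: "f \<in> arr D C" by simp
    have "C \<in> Ob (Cat P)" using Hom_Obs[OF f] by simp
    then have "g \<in> arr C (Two P)"
      using g by (simp add: comp_ftor_def underlying_def topspace_pt_space)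
    moreover have "Dom (Cat P) f = D" "Cod (Cat P) f = C" using f by (simp_all add: Hom_def)
    ultimately show "fn (FAr (comp_ftor (underlying topspace) (pt_ftor P)) f) g =
        fn (FAr (hom_ftor (Cat P) (Two P)) f) g"
      by (simp add: comp_ftor_def underlying_def hom_ftor_def fn_pt_ftor[OF f])
  qed
  show "set_nat_iso (op_cat (Top_C P)) (comp_ftor (Ocar P) (Omega_ftor P \<Lambda>))
      (hom_ftor (Top_C P) Sierpinski) \<theta>"
    unfolding set_nat_iso_def
  proof (intro conjI ballI)
    show "cat_functor (op_cat (Top_C P)) Set_cat (comp_ftor (Ocar P) (Omega_ftor P \<Lambda>))"
      using cat_functor_Omega Set.cat_functor_axioms by (rule cat_functor_comp_ftor)
    show "cat_functor (op_cat (Top_C P)) Set_cat (hom_ftor (Top_C P) Sierpinski)"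
      by (rule cat_functor_hom_ftor) unfold_locales
  next
    fix X assume "X \<in> Ob (op_cat (Top_C P))"
    then have X: "X \<in> Ob (Top_C P)" by simp
    then have "Hom (Top_C P) X Sierpinski = Hom Top_cat X Sierpinski"
      using Sierpinski_Top_C by (auto simp: Hom_Top_C)
    then show "bij_betw (\<theta> X) (FOb (comp_ftor (Ocar P) (Omega_ftor P \<Lambda>)) X)
        (FOb (hom_ftor (Top_C P) Sierpinski) X)"
      using theta_bij[OF X] by (simp add: comp_ftor_def hom_ftor_def)
  next
    fix X Y f b
    assume X: "X \<in> Ob (op_cat (Top_C P))" and "f \<in> Hom (op_cat (Top_C P)) X Y"
      and b: "b \<in> FOb (comp_ftor (Ocar P) (Omega_ftor P \<Lambda>)) X"
    then have f: "f \<in> Hom (Top_C P) Y X" and b': "b \<in> U (\<Omega> X)"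
      by (simp_all add: comp_ftor_def)
    have "Dom (Top_C P) f = Y" "Cod (Top_C P) f = X" using f by (simp_all add: Hom_def)
    moreover have "\<theta> X b \<in> Hom (Top_C P) X Sierpinski"
      using theta_in[OF _ b'] X Sierpinski_Top_C by (simp add: Hom_Top_C)
    ultimately show "\<theta> Y (fn (FAr (comp_ftor (Ocar P) (Omega_ftor P \<Lambda>)) f) b) =
        fn (FAr (hom_ftor (Top_C P) Sierpinski) f) (\<theta> X b)"
      by (simp add: comp_ftor_def hom_ftor_def theta_act_Omega[OF f b'])
  qed
qed

lemma lifts_Top_C_iff:
  assumes X: "X \<in> Ob (Top_C P)" and Y: "Y \<in> Ob (Top_C P)"
  shows "lifts (Top_C P) (underlying topspace) X Y h \<longleftrightarrow> continuous_map X Y h"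
proof
  assume "lifts (Top_C P) (underlying topspace) X Y h"
  then obtain f where "continuous_map X Y f" "\<forall>x\<in>topspace X. f x = h x"
    by (auto simp: lifts_def is_lift_def Hom_Top_C Hom_Top_cat underlying_def)
  then show "continuous_map X Y h" by (auto intro: continuous_map_eq)
next
  assume "continuous_map X Y h"
  then have "continuous_map X Y (restrict h (topspace X))"
    by (rule continuous_map_eq) simp
  then have "is_lift (Top_C P) (underlying topspace) X Y h (Mor X (restrict h (topspace X)) Y)"
    using X Y by (simp add: is_lift_def Hom_Top_C Hom_Top_cat underlying_def)
  then show "lifts (Top_C P) (underlying topspace) X Y h" by (auto simp: lifts_def)
qed

text \<open>Both sides of the lifting criterion say that the sets \<open>{x. \<iota> (\<O> (h x) a) = 1}\<close> are
  open.\<close>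

lemma cartesian_ev_map:
  assumes C: "C \<in> Ob (Cat P)"
  shows "cartesian_family (Top_C P) (underlying topspace) (pt_space P C) Sierpinski
    (U C) (\<lambda>a. ev_map P C a)"
proof -
  note X = pt_space_Top_C[OF C] and S = Sierpinski_Top_C
  have ev: "ev_map P C a \<in> Hom (Top_C P) (pt_space P C) Sierpinski" if "a \<in> U C" for a
    using ev_map_Hom[OF C that] X S by (simp add: Hom_Top_C)
  have "lifts (Top_C P) (underlying topspace) D (pt_space P C) h \<longleftrightarrow>
      (\<forall>a\<in>U C. lifts (Top_C P) (underlying topspace) D Sierpinski (\<lambda>x. fn (ev_map P C a) (h x)))"
    if D: "D \<in> Ob (Top_C P)" and h: "h \<in> topspace D \<rightarrow> arr C (Two P)" for D h
  proof -
    have hx: "fn (ev_map P C a) (h x) = Iota P (act (h x) a)" if "x \<in> topspace D" for x a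
      using h that by (auto intro: fn_ev_map)
    have "{x \<in> topspace D. fn (ev_map P C a) (h x) = 1} =
        {x \<in> topspace D. Iota P (act (h x) a) = 1}" for a
      using hx by auto
    moreover have "(\<lambda>x. fn (ev_map P C a) (h x)) \<in> topspace D \<rightarrow> {0, 1}" if "a \<in> U C" for a
      using hx Iota_act_in[OF _ that] h by (auto simp: Pi_iff)
    ultimately show ?thesis
      using h by (auto simp: lifts_Top_C_iff D X S continuous_map_pt_space_iff[OF C]
        continuous_map_Sierpinski)
  qed
  moreover have "fn (ev_map P C a) \<in> arr C (Two P) \<rightarrow> {0, 1}" if "a \<in> U C" for a
    using Iota_act_in[OF _ that] by (auto simp: ev_map_def)
  ultimately show ?thesis
    using ev X S
    by (simp add: cartesian_family_def cartesian_lift_def underlying_def topspace_pt_space[OF C]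
      bij_betw_def)
qed

lemma cartesian_chi_bar:
  assumes X: "X \<in> Ob (Top_C P)"
  shows "cartesian_family (Cat P) (Ocar P) (\<Omega> X) (Two P) (topspace X) (\<lambda>x. chi_bar P \<Lambda> X x)"
proof -
  have "lifts (Cat P) (Ocar P) D (\<Omega> X) h \<longleftrightarrow>
      (\<forall>x\<in>topspace X. lifts (Cat P) (Ocar P) D (Two P) (\<lambda>b. act (chi_bar P \<Lambda> X x) (h b)))"
    if D: "D \<in> Ob (Cat P)" and h: "h \<in> U D \<rightarrow> U (\<Omega> X)" for D h
    unfolding lifts_to_Omega_iff[OF X D h]
  proof (intro ball_cong refl lifts_cong)
    fix x b assume "x \<in> topspace X" "b \<in> U D"
    then show "chi P x (\<theta> X (h b)) = act (chi_bar P \<Lambda> X x) (h b)"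
      using h by (simp add: act_chi_bar[OF X] Pi_iff)
  qed
  then show ?thesis
    using chi_bar_Hom[OF X] Set.action_closed[OF chi_bar_Hom[OF X]] Two_Ob Omega_Ob[OF X]
    by (auto simp: cartesian_family_def cartesian_lift_def bij_betw_def)
qed

lemma natural_pt_Omega:
  "natural_dual_adjunction (Cat P) (Ocar P) (Top_C P) (underlying topspace)
     (pt_ftor P) (Omega_ftor P \<Lambda>) (eta P \<Lambda>) (sigma P \<Lambda>) (Two P) Sierpinski (\<lambda>C f. f) \<theta>"
  unfolding natural_dual_adjunction_def
proof (intro conjI ballI)
  fix C assume C: "C \<in> Ob (Cat P)"
  show "cartesian_family (Top_C P) (underlying topspace) (FOb (pt_ftor P) C) Sierpinski (U C)
      (\<lambda>c. \<theta> (FOb (pt_ftor P) C) (act (eta P \<Lambda> C) c))"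
    using cartesian_ev_map[OF C] theta_act_eta[OF C]
    by (simp add: cartesian_family_def cartesian_lift_def)
next
  fix X assume X: "X \<in> Ob (Top_C P)"
  show "cartesian_family (Cat P) (Ocar P) (FOb (Omega_ftor P \<Lambda>) X) (Two P)
      (FOb (underlying topspace) X) (\<lambda>x. fn (FAr (underlying topspace) (sigma P \<Lambda> X)) x)"
    using cartesian_chi_bar[OF X] fn_sigma[of _ X]
    by (simp add: underlying_def cartesian_family_def cartesian_lift_def)
qed

end


section \<open>The dual adjunction of an SFC-category\<close>

theorem theorem2p3:
  fixes P :: "('o, 'm :: zero_neq_one, 'a) pfc"
    and \<Lambda> :: "'m topology \<Rightarrow> 'o \<times> ('a \<Rightarrow> ('m topology, 'm) mor)"
  assumes SFC: "SFC P"
    and choice: "lift_choice P \<Lambda>"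
  shows
    "(\<forall>X\<in>Ob (Top_C P). \<forall>x\<in>topspace X.
        is_lift (Cat P) (Ocar P) (Omega_ob \<Lambda> X) (Two P)
          (\<lambda>b. chi P x (theta \<Lambda> X b)) (chi_bar P \<Lambda> X x)) \<and>
     (\<forall>X\<in>Ob (Top_C P). \<forall>Y\<in>Ob (Top_C P). \<forall>f\<in>Hom (Top_C P) X Y.
        is_lift (Cat P) (Ocar P) (Omega_ob \<Lambda> Y) (Omega_ob \<Lambda> X)
          (Omega_fun P \<Lambda> f) (FAr (Omega_ftor P \<Lambda>) f)) \<and>
     (\<forall>C\<in>Ob (Cat P).
        (\<forall>a\<in>FOb (Ocar P) C. ev_map P C a \<in> Hom (Top_C P) (pt_space P C) Sierpinski) \<and>
        is_lift (Cat P) (Ocar P) C (Omega_ob \<Lambda> (pt_space P C))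
          (eta_fun P \<Lambda> C) (eta P \<Lambda> C)) \<and>
     cat_functor (Cat P) (op_cat (Top_C P)) (pt_ftor P) \<and>
     cat_functor (op_cat (Top_C P)) (Cat P) (Omega_ftor P \<Lambda>) \<and>
     adjunction (Cat P) (op_cat (Top_C P)) (pt_ftor P) (Omega_ftor P \<Lambda>)
       (eta P \<Lambda>) (sigma P \<Lambda>) \<and>
     represented_by (Cat P) (Ocar P) (Top_C P) (underlying topspace)
       (pt_ftor P) (Omega_ftor P \<Lambda>) (Two P) Sierpinski (\<lambda>C f. f) (theta \<Lambda>) \<and>
     natural_dual_adjunction (Cat P) (Ocar P) (Top_C P) (underlying topspace)
       (pt_ftor P) (Omega_ftor P \<Lambda>) (eta P \<Lambda>) (sigma P \<Lambda>) (Two P) Sierpinski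
       (\<lambda>C f. f) (theta \<Lambda>)"
proof -
  interpret SFC_choice P \<Lambda>
    using SFC choice by (simp add: SFC_choice_def SFC_choice_axioms_def)
  have "ev_map P C a \<in> Hom (Top_C P) (pt_space P C) Sierpinski"
    if "C \<in> Ob (Cat P)" "a \<in> FOb (Ocar P) C" for C a
    using ev_map_Hom[OF that] pt_space_Top_C[OF that(1)] Sierpinski_Top_C by (simp add: Hom_Top_C)
  then show ?thesis
    using is_lift_chi_bar is_lift_Omega is_lift_eta cat_functor_pt cat_functor_Omega
      adjunction_pt_Omega represented_pt_Omega natural_pt_Omega
    by blast
qed

end
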